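(* Let $\lambda$ be the solution of the spatial coagulation equation described in the context, and assume the moment-control conditions (A1) and (A2) stated there. Assume in addition that the spatial kernel $G$ is of Mercer type: there exist a real Hilbert space $(\mathcal H,\langle\cdot,\cdot\rangle_{\mathcal H})$ and a map $\Phi:\mathcal S\to\mathcal H$ such that $G(x,y)=\langle\Phi(x),\Phi(y)\rangle_{\mathcal H}$ for all $x,y\in\mathcal S$ (in particular $G$ is symmetric, and it is bounded). For $t$ with $M_2(t)\in(0,\infty)$ put $$p_t(x)=\frac{m_2(x,t)}{M_2(t)},\qquad \alpha(t)=\sum_{x,y\in\mathcal S}G(x,y)p_t(x)p_t(y),\qquad \tau(t)=\int_0^t M_2(s)\,ds ,$$ and write $p_\tau$, $\alpha(\tau)$ for $p_t$, $\alpha(t)$ expressed in the rescaled time $\tau=\tau(t)$. Then for every $t$ such that $M_2(t)\in(0,\infty)$, $p_\tau$ (with $\tau=\tau(t)$) satisfies the replicator equation $$\frac{d}{d\tau}p_\tau(x)=p_\tau(x)\bigl((Gp_\tau)(x)-\alpha(\tau)\bigr),\qquad x\in\mathcal S,$$ where $(Gp_\tau)(x)=\sum_{y\in\mathcal S}G(x,y)p_\tau(y)$, and the map $\tau\mapsto\alpha(\tau)$ is nondecreasing. Moreover, the gelation time satisfies $$\frac{1}{\alpha_{\max}M_2(0)}\le t_{\mathrm{gel}}\le\frac{1}{\alpha(0)M_2(0)},$$ where $$\alpha_{\max}:=\sup\Bigl\{\sum_{x,y\in\mathcal S}G(x,y)q(x)q(y)\ :\ q:\mathcal S\to[0,1],\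 \sum_{x\in\mathcal S}q(x)=1\Bigr\}<\infty,$$ with the convention that the upper bound is $+\infty$ if $\alpha(0)=0$.
   Context: Setting. $\mathcal S$ is a finite or countably infinite set, and $G:\mathcal S\times\mathcal S\to(0,\infty)$ is a uniformly bounded function (the spatial kernel). $\mathbb N=\{1,2,\dots\}$. One considers densities $\lambda_t(i,x)\ge0$, $i\in\mathbb N$, $x\in\mathcal S$, solving $$\frac{d}{dt}\lambda_t(i,x)=\sum_{y\in\mathcal S}\sum_{j=1}^{i-1}\frac{j}{i}\,j(i-j)\,G(x,y)\lambda_t(j,x)\lambda_t(i-j,y)-i\,\lambda_t(i,x)\sum_{y\in\mathcal S}\sum_{j\ge1}j\,G(x,y)\lambda_t(j,y),$$ with monodisperse normalised initial condition: $\sum_{i\ge1}i\lambda_0(i,x)=\lambda_0(1,x)$ for every $x$ (so $\lambda_0(i,x)=0$ for $i\ge2$) and $\sum_{x\in\mathcal S}\lambda_0(1,x)=1$. Moments: $m_k(x,t)=\sum_{i\ge1}i^k\lambda_t(i,x)$ and $M_k(t)=\sum_{x\in\mathcal S}m_k(x,t)$, $k\in\mathbb N$. Gelation time: $t_{\mathrm{gel}}=\sup\{t>0: M_2(t)<\infty\}\in(0,\infty]$. The solution $\lambda$ is the (unique) solution up to the gelation time, i.e. on $[0,t_{\mathrm{gel}})$, with $M_2$ bounded on compact subintervals of $[0,t_{\mathrm{gel}})$, and, if $t_{\mathrm{gel}}<\infty$, $M_2(t)\to\infty$ as $t\uparrow t_{\mathrm{gel}}$; this is a standing fact about the solution. Moment-control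 conditions. There is $T_1>0$ (with $[0,T_1)$ contained in the interval $[0,t_{\mathrm{gel}})$ of existence) such that: (A1) for every $x\in\mathcal S$ the series $\sum_{y\in\mathcal S}G(x,y)m_2(x,t)m_1(y,t)$ converges uniformly in $t\in[0,T_1)$; (A2) for every $x\in\mathcal S$ the series $\sum_{y\in\mathcal S}G(x,y)m_2(x,t)m_2(y,t)$ converges uniformly in $t\in[0,T_1)$. *)

theory Defs
  imports "HOL-Analysis.Analysis"
begin

text \<open>A density is a function \<open>lam :: real \<Rightarrow> nat \<Rightarrow> 's \<Rightarrow> real\<close>, where \<open>lam t i x\<close>
  is \<open>\<lambda>\<^sub>t(i,x)\<close>; only \<open>i \<ge> 1\<close> and \<open>x \<in> S\<close> matter. Moments are computed in
  \<open>ennreal\<close>, so that an infinite moment really has the value \<open>\<infinity>\<close>.\<close>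

definition moment :: "(real \<Rightarrow> nat \<Rightarrow> 's \<Rightarrow> real) \<Rightarrow> nat \<Rightarrow> 's \<Rightarrow> real \<Rightarrow> ennreal" where
  "moment lam k x t = (\<Sum>\<^sub>\<infinity>i\<in>{1..}. ennreal (real i ^ k * lam t i x))"

definition total_moment ::
    "'s set \<Rightarrow> (real \<Rightarrow> nat \<Rightarrow> 's \<Rightarrow> real) \<Rightarrow> nat \<Rightarrow> real \<Rightarrow> ennreal" where
  "total_moment S lam k t = (\<Sum>\<^sub>\<infinity>x\<in>S. moment lam k x t)"

definition gel_time :: "'s set \<Rightarrow> (real \<Rightarrow> nat \<Rightarrow> 's \<Rightarrow> real) \<Rightarrow> ereal" where
  "gel_time S lam = Sup {ereal t | t. 0 < t \<and> total_moment S lam 2 t < \<infinity>}"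

definition pregel_times :: "'s set \<Rightarrow> (real \<Rightarrow> nat \<Rightarrow> 's \<Rightarrow> real) \<Rightarrow> real set" where
  "pregel_times S lam = {t. 0 \<le> t \<and> ereal t < gel_time S lam}"

definition coag_rhs ::
    "'s set \<Rightarrow> ('s \<Rightarrow> 's \<Rightarrow> real) \<Rightarrow> (nat \<Rightarrow> 's \<Rightarrow> real) \<Rightarrow> nat \<Rightarrow> 's \<Rightarrow> real" where
  "coag_rhs S G l i x =
     (\<Sum>\<^sub>\<infinity>y\<in>S. \<Sum>j\<in>{1..<i}.
        (real j / real i) * (real j * real (i - j)) * G x y * l j x * l (i - j) y)
     - real i * l i x * (\<Sum>\<^sub>\<infinity>y\<in>S. \<Sum>\<^sub>\<infinity>j\<in>{1..}. real j * G x y * l j y)"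

text \<open>A solution up to the gelation time with monodisperse normalised initial condition.
  The time derivative is taken within \<open>[0, t\<^sub>g\<^sub>e\<^sub>l)\<close>, hence is one-sided at \<open>0\<close>.
  Nothing is required of \<open>lam\<close> outside that interval beyond what the definition of
  \<open>gel_time\<close> itself says.\<close>

definition coag_solution ::
    "'s set \<Rightarrow> ('s \<Rightarrow> 's \<Rightarrow> real) \<Rightarrow> (real \<Rightarrow> nat \<Rightarrow> 's \<Rightarrow> real) \<Rightarrow> bool" where
  "coag_solution S G lam \<longleftrightarrow>
     0 < gel_time S lam \<and>
     (\<forall>t\<in>pregel_times S lam. \<forall>i\<ge>1. \<forall>x\<in>S. 0 \<le> lam t i x) \<and>
     (\<forall>t\<in>pregel_times S lam. \<forall>i\<ge>1. \<forall>x\<in>S.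
        ((\<lambda>s. lam s i x) has_real_derivative coag_rhs S G (lam t) i x)
          (at t within pregel_times S lam)) \<and>
     (\<forall>x\<in>S. moment lam 1 x 0 = ennreal (lam 0 1 x)) \<and>
     ((\<lambda>x. lam 0 1 x) has_sum 1) S \<and>
     (\<forall>T\<in>pregel_times S lam. \<exists>B::real. \<forall>t\<in>{0..T}. total_moment S lam 2 t \<le> ennreal B) \<and>
     (\<forall>T. gel_time S lam = ereal T \<longrightarrow> (total_moment S lam 2 \<longlongrightarrow> \<infinity>) (at_left T))"

text \<open>Uniform convergence on \<open>[0, T1)\<close> of the series of \<open>G(x,y) m\<^sub>2(x,t) m\<^sub>k(y,t)\<close>
  over \<open>y\<close>, along the finite subsets of \<open>S\<close>. As the terms are nonnegative, this does not
  differ from uniform convergence along an enumeration of \<open>S\<close>.\<close>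

definition moment_control ::
    "'s set \<Rightarrow> ('s \<Rightarrow> 's \<Rightarrow> real) \<Rightarrow> (real \<Rightarrow> nat \<Rightarrow> 's \<Rightarrow> real) \<Rightarrow> nat \<Rightarrow> real \<Rightarrow> bool" where
  "moment_control S G lam k T1 \<longleftrightarrow>
     (\<forall>x\<in>S. uniform_limit {0..<T1}
        (\<lambda>F t. \<Sum>y\<in>F. G x y * enn2real (moment lam 2 x t) * enn2real (moment lam k y t))
        (\<lambda>t. \<Sum>\<^sub>\<infinity>y\<in>S. G x y * enn2real (moment lam 2 x t) * enn2real (moment lam k y t))
        (finite_subsets_at_top S))"

definition prof :: "'s set \<Rightarrow> (real \<Rightarrow> nat \<Rightarrow> 's \<Rightarrow> real) \<Rightarrow> real \<Rightarrow> 's \<Rightarrow> real" where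
  "prof S lam t x = enn2real (moment lam 2 x t) / enn2real (total_moment S lam 2 t)"

definition kernel_app :: "'s set \<Rightarrow> ('s \<Rightarrow> 's \<Rightarrow> real) \<Rightarrow> ('s \<Rightarrow> real) \<Rightarrow> 's \<Rightarrow> real" where
  "kernel_app S G q x = (\<Sum>\<^sub>\<infinity>y\<in>S. G x y * q y)"

definition kernel_form :: "'s set \<Rightarrow> ('s \<Rightarrow> 's \<Rightarrow> real) \<Rightarrow> ('s \<Rightarrow> real) \<Rightarrow> real" where
  "kernel_form S G q = (\<Sum>\<^sub>\<infinity>(x, y)\<in>S \<times> S. G x y * q x * q y)"

definition alpha ::
    "'s set \<Rightarrow> ('s \<Rightarrow> 's \<Rightarrow> real) \<Rightarrow> (real \<Rightarrow> nat \<Rightarrow> 's \<Rightarrow> real) \<Rightarrow> real \<Rightarrow> real" where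
  "alpha S G lam t = kernel_form S G (prof S lam t)"

definition alpha_max :: "'s set \<Rightarrow> ('s \<Rightarrow> 's \<Rightarrow> real) \<Rightarrow> ereal" where
  "alpha_max S G =
     Sup {ereal (kernel_form S G q) | q. (\<forall>x\<in>S. q x \<in> {0..1}) \<and> (q has_sum 1) S}"

definition tau :: "'s set \<Rightarrow> (real \<Rightarrow> nat \<Rightarrow> 's \<Rightarrow> real) \<Rightarrow> real \<Rightarrow> real" where
  "tau S lam t = integral {0..t} (\<lambda>s. enn2real (total_moment S lam 2 s))"

definition orig_time :: "'s set \<Rightarrow> (real \<Rightarrow> nat \<Rightarrow> 's \<Rightarrow> real) \<Rightarrow> real \<Rightarrow> real" where
  "orig_time S lam = the_inv_into (pregel_times S lam) (tau S lam)"

definition prof_resc :: "'s set \<Rightarrow> (real \<Rightarrow> nat \<Rightarrow> 's \<Rightarrow> real) \<Rightarrow> real \<Rightarrow> 's \<Rightarrow> real" where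
  "prof_resc S lam u = prof S lam (orig_time S lam u)"

definition alpha_resc ::
    "'s set \<Rightarrow> ('s \<Rightarrow> 's \<Rightarrow> real) \<Rightarrow> (real \<Rightarrow> nat \<Rightarrow> 's \<Rightarrow> real) \<Rightarrow> real \<Rightarrow> real" where
  "alpha_resc S G lam u = alpha S G lam (orig_time S lam u)"

end

theory Submission
  imports Defs
begin

text \<open>
  Testing the coagulation equation against \<open>i \<psi>(i)\<close> gives
  \<open>\<Sum>\<^sub>y\<^sub>,\<^sub>j\<^sub>,\<^sub>k G(x,y) (\<psi>(j + k) - \<psi>(j)) j\<^sup>2 k \<lambda>(j,x) \<lambda>(k,y)\<close> on the right-hand side. If \<open>\<psi>\<close> is a tent
  function, it has finite support and is \<open>1\<close>-Lipschitz, so the terms are dominated by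
  \<open>j\<^sup>2 k\<^sup>2 \<lambda>(j,x) \<lambda>(k,y)\<close>. Letting the tents grow to the identity yields, without any third moment,
  the integrated form of \<open>m\<^sub>2' = m\<^sub>2 \<cdot> G m\<^sub>2\<close>. Hence \<open>m\<^sub>2(x,\<cdot>)\<close> is nondecreasing and Lipschitz on
  compact time intervals with constants summable in \<open>x\<close>, so that all sums over \<open>x\<close> can be
  differentiated termwise: \<open>M\<^sub>2' = \<alpha> M\<^sub>2\<^sup>2\<close>, and \<open>\<alpha>'\<close> is \<open>2 M\<^sub>2\<close> times the variance of \<open>G p\<close>
  under \<open>p\<close>, by symmetry of \<open>G\<close>. Integrating \<open>(1 / M\<^sub>2)' = - \<alpha>\<close> with
  \<open>\<alpha>(0) \<le> \<alpha> \<le> \<alpha>\<^sub>m\<^sub>a\<^sub>x\<close> bounds the gelation time.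
\<close>

subsection \<open>Infinite sums and derivatives\<close>

text \<open>Every finite partial sum of \<open>f\<close> is bounded by the finite
  \<open>ennreal\<close> total, and bounded partial sums of nonnegative reals give summability. The
  values then agree because \<open>ennreal\<close> is additive on nonnegative reals and
  continuous.\<close>

lemma infsum_ennreal_finite:
  fixes f :: "'a \<Rightarrow> real"
  assumes nonneg: "\<And>x. x \<in> A \<Longrightarrow> 0 \<le> f x"
    and fin: "(\<Sum>\<^sub>\<infinity>x\<in>A. ennreal (f x)) < \<infinity>"
  shows "f summable_on A" and "(\<Sum>\<^sub>\<infinity>x\<in>A. ennreal (f x)) = ennreal (infsum f A)"
proof -
  have sum_eq: "sum (ennreal \<circ> f) F = ennreal (sum f F)" if "finite F" "F \<subseteq> A" for F
    unfolding comp_def by (rule sum_ennreal) (use nonneg that in auto)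
  have "sum f F \<le> enn2real (\<Sum>\<^sub>\<infinity>x\<in>A. ennreal (f x))" if "finite F" "F \<subseteq> A" for F
  proof -
    have "ennreal (sum f F) \<le> (\<Sum>\<^sub>\<infinity>x\<in>A. ennreal (f x))"
      unfolding sum_eq[OF that, symmetric]
      by (subst infsum_finite[OF that(1), symmetric], rule infsum_mono_neutral)
         (use that in \<open>auto intro: nonneg_summable_on_complete\<close>)
    moreover have "0 \<le> sum f F"
      by (rule sum_nonneg) (use nonneg that in auto)
    ultimately show ?thesis
      using fin by (metis enn2real_ennreal enn2real_mono infinity_ennreal_def)
  qed
  then have "\<forall>\<^sub>F F in finite_subsets_at_top A.
      sum f F \<le> enn2real (\<Sum>\<^sub>\<infinity>x\<in>A. ennreal (f x))"
    by (intro eventually_finite_subsets_at_top_weakI) auto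
  then show summable: "f summable_on A"
    using nonneg by (rule nonneg_bounded_partial_sums_imp_summable_on[rotated])
  show "(\<Sum>\<^sub>\<infinity>x\<in>A. ennreal (f x)) = ennreal (infsum f A)"
    using infsum_comm_additive_general[OF sum_eq _ summable] by (simp add: comp_def)
qed

text \<open>A finite total forces every term to be finite, so passing through
  \<open>ennreal (enn2real _)\<close> changes no term.\<close>

lemma enn2real_infsum:
  fixes f :: "'a \<Rightarrow> ennreal"
  assumes "infsum f A < \<infinity>"
  shows "((\<lambda>x. enn2real (f x)) has_sum enn2real (infsum f A)) A"
proof -
  have "f x < \<infinity>" if "x \<in> A" for x
  proof -
    have "f x = infsum f {x}"
      by simp
    also have "\<dots> \<le> infsum f A"
      by (rule infsum_mono_neutral) (use that in \<open>auto intro: nonneg_summable_on_complete\<close>)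
    finally show ?thesis
      using assms by (rule le_less_trans)
  qed
  then have eq: "infsum f A = (\<Sum>\<^sub>\<infinity>x\<in>A. ennreal (enn2real (f x)))"
    by (intro infsum_cong) auto
  show ?thesis
    using infsum_ennreal_finite[of A "\<lambda>x. enn2real (f x)"] assms eq
    by (auto simp: has_sum_infsum infsum_nonneg)
qed

text \<open>Dominated convergence for unordered sums: by the Weierstrass test the finite partial
  sums converge uniformly on the set of those \<open>y\<close> that satisfy the bound, so the two
  limits may be exchanged.\<close>

lemma tendsto_infsum_dominated:
  fixes f :: "'b \<Rightarrow> 'a \<Rightarrow> 'c :: banach"
  assumes summable: "g summable_on A"
    and bound: "\<forall>\<^sub>F y in F. \<forall>x\<in>A. norm (f y x) \<le> g x"
    and lim: "\<And>x. x \<in> A \<Longrightarrow> ((\<lambda>y. f y x) \<longlongrightarrow> h x) F"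
    and "F \<noteq> bot"
  shows "((\<lambda>y. infsum (f y) A) \<longlongrightarrow> infsum h A) F"
proof (rule swap_uniform_limit'[where S = "{y. \<forall>x\<in>A. norm (f y x) \<le> g x}"
        and f = "\<lambda>X y. \<Sum>x\<in>X. f y x" and g = "\<lambda>X. \<Sum>x\<in>X. h x" and F = "finite_subsets_at_top A"])
  show "\<forall>\<^sub>F X in finite_subsets_at_top A. ((\<lambda>y. \<Sum>x\<in>X. f y x) \<longlongrightarrow> (\<Sum>x\<in>X. h x)) F"
    by (intro eventually_finite_subsets_at_top_weakI tendsto_sum lim) auto
  have "norm (h x) \<le> g x" if "x \<in> A" for x
    using bound that
    by (intro tendsto_upperbound[OF tendsto_norm[OF lim[OF that]] _ \<open>F \<noteq> bot\<close>])
       (auto elim: eventually_mono)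
  then have "h summable_on A"
    by (rule abs_summable_summable[OF summable_on_comparison_test[OF summable]]) auto
  then show "((\<lambda>X. \<Sum>x\<in>X. h x) \<longlongrightarrow> infsum h A) (finite_subsets_at_top A)"
    using has_sum_def has_sum_infsum by blast
  show "uniform_limit {y. \<forall>x\<in>A. norm (f y x) \<le> g x} (\<lambda>X y. \<Sum>x\<in>X. f y x)
      (\<lambda>y. infsum (f y) A) (finite_subsets_at_top A)"
    by (rule Weierstrass_m_test_general[OF _ summable]) auto
qed (use bound in auto)

text \<open>On the convex set \<open>X\<close> the mean value inequality bounds each difference
  quotient by \<open>g a\<close>, so dominated convergence applies to the sum of the
  quotients.\<close>

lemma has_real_derivative_infsum:
  fixes f f' :: "'a \<Rightarrow> real \<Rightarrow> real"
  assumes "convex X" and t: "t \<in> X"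
    and deriv: "\<And>a s. a \<in> A \<Longrightarrow> s \<in> X \<Longrightarrow> (f a has_real_derivative f' a s) (at s within X)"
    and bound: "\<And>a s. a \<in> A \<Longrightarrow> s \<in> X \<Longrightarrow> \<bar>f' a s\<bar> \<le> g a"
    and summable_bound: "g summable_on A"
    and summable: "\<And>s. s \<in> X \<Longrightarrow> (\<lambda>a. f a s) summable_on A"
  shows "((\<lambda>s. \<Sum>\<^sub>\<infinity>a\<in>A. f a s) has_real_derivative (\<Sum>\<^sub>\<infinity>a\<in>A. f' a t)) (at t within X)"
proof (cases "at t within X = bot")
  case False
  have "((\<lambda>s. \<Sum>\<^sub>\<infinity>a\<in>A. (f a s - f a t) / (s - t)) \<longlongrightarrow> (\<Sum>\<^sub>\<infinity>a\<in>A. f' a t)) (at t within X)"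
  proof (rule tendsto_infsum_dominated[OF summable_bound _ _ False])
    have "norm ((f a s - f a t) / (s - t)) \<le> g a" if "s \<in> X" "s \<noteq> t" "a \<in> A" for s a
    proof -
      have "norm (f a s - f a t) \<le> g a * norm (s - t)"
        by (rule field_differentiable_bound[OF \<open>convex X\<close> deriv])
           (use that t bound in auto)
      then show ?thesis
        using that by (simp add: field_simps)
    qed
    then show "\<forall>\<^sub>F s in at t within X. \<forall>a\<in>A. norm ((f a s - f a t) / (s - t)) \<le> g a"
      by (auto simp: eventually_at_filter)
    show "((\<lambda>s. (f a s - f a t) / (s - t)) \<longlongrightarrow> f' a t) (at t within X)" if "a \<in> A" for a
      using deriv[OF that t] by (simp add: has_field_derivative_iff)
  qed
  moreover have "(\<Sum>\<^sub>\<infinity>a\<in>A. (f a s - f a t) / (s - t)) =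
      ((\<Sum>\<^sub>\<infinity>a\<in>A. f a s) - (\<Sum>\<^sub>\<infinity>a\<in>A. f a t)) / (s - t)" if "s \<in> X" for s
    using has_sum_add[OF has_sum_infsum[OF summable[OF that]]
        has_sum_uminusI[OF has_sum_infsum[OF summable[OF t]]]]
    by (simp add: divide_inverse infsum_cmult_left' infsumI)
  ultimately show ?thesis
    unfolding has_field_derivative_iff
    by (elim Lim_transform_eventually) (auto simp: eventually_at_filter)
qed (simp add: has_field_derivative_iff)

text \<open>Tonelli: for nonnegative terms, convergence of the iterated sum already gives
  convergence over the product.\<close>

lemma has_sum_times_nonneg:
  fixes f :: "'a \<Rightarrow> real" and g :: "'b \<Rightarrow> real"
  assumes f: "(f has_sum a) A" and g: "(g has_sum b) B"
    and "\<And>x. x \<in> A \<Longrightarrow> 0 \<le> f x" and "\<And>y. y \<in> B \<Longrightarrow> 0 \<le> g y"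
  shows "((\<lambda>(x, y). f x * g y) has_sum a * b) (A \<times> B)"
proof -
  have inner: "((\<lambda>y. f x * g y) has_sum f x * b) B" for x
    using g by (rule has_sum_cmult_right)
  have outer: "((\<lambda>x. f x * b) has_sum a * b) A"
    using f by (rule has_sum_cmult_left)
  show ?thesis
    by (rule has_sum_SigmaI[OF _ outer summable_on_SigmaI[where g = "\<lambda>x. f x * b"]])
       (use inner outer assms in \<open>auto simp: summable_on_def\<close>)
qed

text \<open>Strictly between \<open>s\<close> and \<open>t\<close> the derivative within
  \<open>X\<close> is an ordinary derivative; at the two endpoints continuity is enough. Thus a
  one-sided derivative at the boundary of \<open>X\<close> does no harm.\<close>

lemma has_real_derivative_nonneg_imp_mono_on:
  fixes f f' :: "real \<Rightarrow> real"
  assumes X: "is_interval X"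
    and deriv: "\<And>t. t \<in> X \<Longrightarrow> (f has_real_derivative f' t) (at t within X)"
    and nonneg: "\<And>t. t \<in> X \<Longrightarrow> 0 \<le> f' t"
  shows "mono_on X f"
proof (rule mono_onI)
  fix s t assume st: "s \<in> X" "t \<in> X" "s \<le> t"
  then have sub: "{s..t} \<subseteq> X"
    using mem_is_interval_1_I[OF X] by (meson atLeastAtMost_iff subsetI)
  show "f s \<le> f t"
  proof (rule DERIV_nonneg_imp_increasing_open[OF \<open>s \<le> t\<close>])
    fix u assume u: "s < u" "u < t"
    then have "u \<in> interior X"
      by (intro interiorI[of "{s<..<t}"]) (use sub in auto)
    moreover have "u \<in> X"
      using u sub by auto
    ultimately show "\<exists>y. DERIV f u :> y \<and> 0 \<le> y"
      using deriv nonneg by (metis at_within_interior)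
  next
    show "continuous_on {s..t} f"
      by (rule continuous_on_subset[OF DERIV_continuous_on[OF deriv] sub])
  qed
qed

lemma has_real_derivative_the_inv_into:
  fixes f h :: "real \<Rightarrow> real"
  assumes "0 < c" and expand: "\<And>s t. s \<in> X \<Longrightarrow> t \<in> X \<Longrightarrow> c * \<bar>s - t\<bar> \<le> \<bar>f s - f t\<bar>"
    and t: "t \<in> X" and "D \<noteq> 0"
    and f: "(f has_real_derivative D) (at t within X)"
    and h: "(h has_real_derivative E) (at t within X)"
  shows "((\<lambda>u. h (the_inv_into X f u)) has_real_derivative E / D) (at (f t) within f ` X)"
proof -
  let ?g = "the_inv_into X f"
  have inj: "inj_on f X"
    using expand \<open>0 < c\<close> by (fastforce simp: inj_on_def mult_le_0_iff)
  then have g: "?g (f s) = s" if "s \<in> X" for s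
    using that by (simp add: the_inv_into_f_f)
  have "((\<lambda>u. \<bar>?g u - t\<bar>) \<longlongrightarrow> 0) (at (f t) within f ` X)"
  proof (rule tendsto_sandwich[where f = "\<lambda>_. 0"])
    show "\<forall>\<^sub>F u in at (f t) within f ` X. \<bar>?g u - t\<bar> \<le> \<bar>u - f t\<bar> / c"
      unfolding eventually_at_filter
      by (intro always_eventually) (use expand[OF _ t] \<open>0 < c\<close> g in \<open>auto simp: field_simps\<close>)
    have "((\<lambda>u. \<bar>u - f t\<bar> / c) \<longlongrightarrow> \<bar>f t - f t\<bar> / c) (at (f t) within f ` X)"
      using \<open>0 < c\<close> by (intro tendsto_intros) auto
    then show "((\<lambda>u. \<bar>u - f t\<bar> / c) \<longlongrightarrow> 0) (at (f t) within f ` X)"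
      by simp
  qed auto
  then have "(?g \<longlongrightarrow> t) (at (f t) within f ` X)"
    by (metis LIM_zero_cancel tendsto_rabs_zero_iff)
  then have "filterlim ?g (at t within X) (at (f t) within f ` X)"
    unfolding filterlim_at eventually_at_filter
    by (intro conjI always_eventually) (use g in auto)
  moreover have "((\<lambda>s. ((h s - h t) / (s - t)) / ((f s - f t) / (s - t))) \<longlongrightarrow> E / D)
      (at t within X)"
    using f h \<open>D \<noteq> 0\<close> by (intro tendsto_divide) (auto simp: has_field_derivative_iff)
  ultimately have "((\<lambda>u. ((h (?g u) - h t) / (?g u - t)) / ((f (?g u) - f t) / (?g u - t)))
      \<longlongrightarrow> E / D) (at (f t) within f ` X)"
    by (rule filterlim_compose[rotated])
  then show ?thesis
    unfolding has_field_derivative_iff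
    by (rule Lim_transform_eventually, unfold eventually_at_filter, intro always_eventually)
       (use g t in auto)
qed

subsection \<open>Weak form of the coagulation operator\<close>

text \<open>A cutoff of the weight \<open>i\<close> that is finitely supported and still \<open>1\<close>-Lipschitz.\<close>

definition tent :: "nat \<Rightarrow> nat \<Rightarrow> real" where
  "tent n i = max 0 (min (real i) (2 * real n - real i))"

lemma tent_bounds: "0 \<le> tent n i" "tent n i \<le> real i"
  by (auto simp: tent_def)

lemma tent_lipschitz: "\<bar>tent n (j + k) - tent n j\<bar> \<le> real k"
  by (auto simp: tent_def max_def min_def)

lemma tent_outside: "2 * n \<le> i \<Longrightarrow> tent n i = 0"
  by (auto simp: tent_def)

lemma tent_tendsto: "(\<lambda>n. tent n i) \<longlonglongrightarrow> real i"
  by (rule tendsto_eventually, rule eventually_sequentiallyI[of i]) (auto simp: tent_def)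

text \<open>With \<open>A j\<close> standing for j^2 \<lambda>(j,x) and \<open>B k\<close> for the
  sum over y of k G(x,y) \<lambda>(k,y), the bracket is \<open>i\<close> times the coagulation
  right-hand side. The whole is then the rate of change of the sum of \<open>tent n i\<close> i
  \<lambda>(i,x).\<close>

definition tent_flux :: "(nat \<Rightarrow> real) \<Rightarrow> (nat \<Rightarrow> real) \<Rightarrow> nat \<Rightarrow> real" where
  "tent_flux A B n =
     (\<Sum>i=1..2*n. tent n i * ((\<Sum>j\<in>{1..<i}. A j * B (i - j)) - A i * infsum B UNIV))"

context
  fixes A B :: "nat \<Rightarrow> real"
  assumes A_nonneg: "\<And>j. 0 \<le> A j" and B_nonneg: "\<And>k. 0 \<le> B k"
    and A_0: "A 0 = 0" and B_0: "B 0 = 0"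
    and A_summable: "A summable_on UNIV" and B_summable: "(\<lambda>k. real k * B k) summable_on UNIV"
begin

lemma flux_partner_summable: "B summable_on UNIV"
proof (rule summable_on_comparison_test[OF B_summable])
  show "B k \<le> real k * B k" for k
    using B_0 B_nonneg[of k] by (cases k) (auto simp: field_simps)
qed (rule B_nonneg)

text \<open>Writing \<open>i = j + k\<close> turns the gain into a sum over pairs, and the loss is a
  product of two sums, hence also a sum over pairs. Only their difference exhibits the increment of
  \<open>tent n\<close>, to which the Lipschitz bound applies.\<close>

lemma tent_flux_has_sum:
  "((\<lambda>(j, k). (tent n (j + k) - tent n j) * (A j * B k)) has_sum tent_flux A B n) (UNIV \<times> UNIV)"
proof -
  let ?I = "SIGMA i:{1..2*n}. {1..<i}"
  \<comment> \<open>These pairs carry the whole gain: \<open>A 0\<close> and \<open>B 0\<close>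
    vanish, and so does \<open>tent n\<close> from \<open>2 * n\<close> on.\<close>
  let ?P = "{(j, k). 1 \<le> j \<and> 1 \<le> k \<and> j + k \<le> 2 * n}"
  have "?P \<subseteq> {..2*n} \<times> {..2*n}"
    by auto
  then have fin: "finite ?P"
    by (rule finite_subset) auto
  have "(\<Sum>i=1..2*n. tent n i * (\<Sum>j\<in>{1..<i}. A j * B (i - j))) =
      (\<Sum>(i, j)\<in>?I. tent n i * (A j * B (i - j)))"
    by (subst sum.Sigma[symmetric]) (auto simp: sum_distrib_left)
  also have "\<dots> = (\<Sum>(j, k)\<in>?P. tent n (j + k) * (A j * B k))"
    by (rule sum.reindex_bij_witness[of _ "\<lambda>(j, k). (j + k, j)" "\<lambda>(i, j). (j, i - j)"]) auto
  also have "((\<lambda>(j, k). tent n (j + k) * (A j * B k)) has_sum \<dots>) (UNIV \<times> UNIV)"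
  proof (rule has_sum_finite_neutralI[OF fin])
    fix p assume "p \<in> UNIV \<times> UNIV - ?P"
    moreover obtain j k where p: "p = (j, k)"
      by fastforce
    ultimately have "j = 0 \<or> k = 0 \<or> 2 * n \<le> j + k"
      by auto
    then show "(case p of (j, k) \<Rightarrow> tent n (j + k) * (A j * B k)) = 0"
      using p A_0 B_0 tent_outside by auto
  qed auto
  finally have "((\<lambda>(j, k). tent n (j + k) * (A j * B k)) has_sum
      (\<Sum>i=1..2*n. tent n i * (\<Sum>j\<in>{1..<i}. A j * B (i - j)))) (UNIV \<times> UNIV)" .
  moreover have "((\<lambda>j. tent n j * A j) has_sum (\<Sum>i=1..2*n. tent n i * A i)) UNIV"
    using A_0 by (intro has_sum_finite_neutralI[of "{1..2*n}"])
      (auto simp: not_le tent_outside Suc_le_eq)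
  then have "((\<lambda>(j, k). (tent n j * A j) * B k) has_sum
      (\<Sum>i=1..2*n. tent n i * A i) * infsum B UNIV) (UNIV \<times> UNIV)"
    using flux_partner_summable
    by (intro has_sum_times_nonneg) (auto simp: A_nonneg B_nonneg tent_bounds)
  then have "((\<lambda>(j, k). - (tent n j * (A j * B k))) has_sum
      - ((\<Sum>i=1..2*n. tent n i * A i) * infsum B UNIV)) (UNIV \<times> UNIV)"
    by (subst has_sum_uminus[symmetric]) (simp add: case_prod_unfold mult.assoc)
  ultimately have "((\<lambda>p. (case p of (j, k) \<Rightarrow> tent n (j + k) * (A j * B k)) +
      (case p of (j, k) \<Rightarrow> - (tent n j * (A j * B k)))) has_sum tent_flux A B n) (UNIV \<times> UNIV)"
    by (auto dest: has_sum_add simp: tent_flux_def algebra_simps sum_subtractf sum_distrib_left)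
  then show ?thesis
    by (simp add: case_prod_unfold algebra_simps)
qed

text \<open>This family is both a majorant of the flux terms, uniformly in \<open>n\<close>, and
  their limit, since the increment of \<open>tent n\<close> from \<open>j\<close> to
  \<open>j + k\<close> is at most \<open>k\<close> and tends to \<open>k\<close>.\<close>

lemma tent_flux_dominator:
  "((\<lambda>(j, k). A j * (real k * B k)) has_sum infsum A UNIV * (\<Sum>\<^sub>\<infinity>k. real k * B k)) (UNIV \<times> UNIV)"
  using A_summable B_summable by (intro has_sum_times_nonneg) (auto simp: A_nonneg B_nonneg)

lemma tent_flux_term_bound:
  "\<bar>(tent n (j + k) - tent n j) * (A j * B k)\<bar> \<le> A j * (real k * B k)"
proof -
  have "\<bar>(tent n (j + k) - tent n j) * (A j * B k)\<bar> = \<bar>tent n (j + k) - tent n j\<bar> * (A j * B k)"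
    by (simp add: abs_mult A_nonneg B_nonneg)
  also have "\<dots> \<le> real k * (A j * B k)"
    by (intro mult_right_mono tent_lipschitz mult_nonneg_nonneg A_nonneg B_nonneg)
  finally show ?thesis
    by (simp add: mult_ac)
qed

lemma tent_flux_bound: "\<bar>tent_flux A B n\<bar> \<le> infsum A UNIV * (\<Sum>\<^sub>\<infinity>k. real k * B k)"
  using norm_infsum_le[OF tent_flux_has_sum[of n] tent_flux_dominator] tent_flux_term_bound
  by auto

lemma tent_flux_tendsto: "tent_flux A B \<longlonglongrightarrow> infsum A UNIV * (\<Sum>\<^sub>\<infinity>k. real k * B k)"
proof -
  let ?h = "\<lambda>p. case p of (j, k) \<Rightarrow> A j * (real k * B k)"
  let ?f = "\<lambda>n p. case p of (j, k) \<Rightarrow> (tent n (j + k) - tent n j) * (A j * B k)"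
  have "(\<lambda>n. infsum (?f n) (UNIV \<times> UNIV)) \<longlonglongrightarrow> infsum ?h (UNIV \<times> UNIV)"
  proof (rule tendsto_infsum_dominated[of ?h])
    show "?h summable_on UNIV \<times> UNIV"
      using tent_flux_dominator by (rule has_sum_imp_summable)
    show "\<forall>\<^sub>F n in sequentially. \<forall>p\<in>UNIV \<times> UNIV. norm (?f n p) \<le> ?h p"
      using tent_flux_term_bound by (intro always_eventually) auto
    show "(\<lambda>n. ?f n p) \<longlonglongrightarrow> ?h p" for p
    proof (cases p)
      case (Pair j k)
      have "(\<lambda>n. (tent n (j + k) - tent n j) * (A j * B k)) \<longlonglongrightarrow>
          (real (j + k) - real j) * (A j * B k)"
        by (intro tendsto_intros tent_tendsto)
      then show ?thesis
        using Pair by (simp add: mult_ac)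
    qed
  qed simp
  then show ?thesis
    using infsumI[OF tent_flux_has_sum] infsumI[OF tent_flux_dominator] by simp
qed

end

section \<open>The coagulation right-hand side as a flux\<close>

lemma has_sum_finite_sum:
  fixes f :: "'i \<Rightarrow> 'a \<Rightarrow> 'b :: topological_comm_monoid_add"
  assumes "finite I" and "\<And>i. i \<in> I \<Longrightarrow> (f i has_sum s i) A"
  shows "((\<lambda>x. \<Sum>i\<in>I. f i x) has_sum (\<Sum>i\<in>I. s i)) A"
  using assms by (induction I) (auto intro: has_sum_add)

lemma has_sum_atLeast_1_iff_UNIV:
  fixes f :: "nat \<Rightarrow> real"
  assumes "f 0 = 0"
  shows "(f has_sum s) {1..} \<longleftrightarrow> (f has_sum s) UNIV"
  by (rule has_sum_cong_neutral) (use assms in \<open>auto simp: not_le\<close>)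

context
  fixes S :: "'s set" and G :: "'s \<Rightarrow> 's \<Rightarrow> real" and l :: "nat \<Rightarrow> 's \<Rightarrow> real" and \<mu> :: "'s \<Rightarrow> real"
    and x :: 's and C :: real and A B :: "nat \<Rightarrow> real"
  assumes x: "x \<in> S"
    and G: "\<And>y. y \<in> S \<Longrightarrow> 0 \<le> G x y" "\<And>y. y \<in> S \<Longrightarrow> G x y \<le> C"
    and l_nonneg: "\<And>i y. 1 \<le> i \<Longrightarrow> y \<in> S \<Longrightarrow> 0 \<le> l i y"
    and \<mu>: "\<And>y. y \<in> S \<Longrightarrow> ((\<lambda>i. real i ^ 2 * l i y) has_sum \<mu> y) {1..}"
    and \<mu>_summable: "\<mu> summable_on S"
  defines "A \<equiv> \<lambda>j. real j ^ 2 * l j x"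
    and "B \<equiv> \<lambda>k. \<Sum>\<^sub>\<infinity>y\<in>S. real k * G x y * l k y"
begin

lemma partner_weight_nonneg: "y \<in> S \<Longrightarrow> 0 \<le> real k * G x y * l k y"
  by (cases k) (auto simp: G l_nonneg)

text \<open>The extra factor \<open>k\<close> is at least 1 except at \<open>k = 0\<close>, where
  both sides vanish. It lets second-moment bounds control the first-moment sums in the
  equation.\<close>

lemma partner_weight_le: "y \<in> S \<Longrightarrow> real k * G x y * l k y \<le> real k * (real k * G x y * l k y)"
  using mult_right_mono[OF _ partner_weight_nonneg[of y k], of 1 "real k"] by (cases "k = 0") auto

text \<open>The bound \<open>C\<close> on the kernel dominates the series over \<open>y\<close> by a
  multiple of \<open>\<mu>\<close>. Joint summability over \<open>(y, k)\<close> is what later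
  allows summation in either order.\<close>

lemma weighted_second_moment:
  "((\<lambda>(y, k). real k * (real k * G x y * l k y)) has_sum (\<Sum>\<^sub>\<infinity>y\<in>S. G x y * \<mu> y)) (S \<times> UNIV)"
proof -
  have \<mu>_nonneg: "0 \<le> \<mu> y" if "y \<in> S" for y
    using \<mu>[OF that] by (rule has_sum_nonneg) (use that l_nonneg in auto)
  have inner: "((\<lambda>k. real k * (real k * G x y * l k y)) has_sum G x y * \<mu> y) UNIV" if "y \<in> S" for y
    using has_sum_cmult_right[OF \<mu>[OF that, THEN has_sum_atLeast_1_iff_UNIV[THEN iffD1, rotated]], of "G x y"]
    by (simp add: power2_eq_square mult_ac)
  have outer: "(\<lambda>y. G x y * \<mu> y) summable_on S"
    by (rule summable_on_comparison_test[OF summable_on_cmult_right[OF \<mu>_summable, of C]])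
       (auto intro: mult_right_mono mult_nonneg_nonneg G \<mu>_nonneg)
  show ?thesis
    by (rule has_sum_SigmaI[OF _ has_sum_infsum[OF outer] summable_on_SigmaI[OF _ outer]])
       (use inner partner_weight_nonneg in auto)
qed

lemma partner_weight_summable: "(\<lambda>y. real k * G x y * l k y) summable_on S"
proof -
  have "(\<lambda>(k, y). real k * (real k * G x y * l k y)) summable_on UNIV \<times> S"
    using has_sum_imp_summable[OF weighted_second_moment]
    by (subst (asm) summable_on_swap) simp
  then have "(\<lambda>y. real k * (real k * G x y * l k y)) summable_on S"
    by (rule summable_on_SigmaD1) simp
  then show ?thesis
    by (rule summable_on_comparison_test) (auto simp: partner_weight_le partner_weight_nonneg)
qed

lemma partner_second_moment: "((\<lambda>k. real k * B k) has_sum (\<Sum>\<^sub>\<infinity>y\<in>S. G x y * \<mu> y)) UNIV"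
proof (rule has_sum_SigmaD)
  show "((\<lambda>(k, y). real k * (real k * G x y * l k y)) has_sum (\<Sum>\<^sub>\<infinity>y\<in>S. G x y * \<mu> y)) (UNIV \<times> S)"
    using weighted_second_moment by (subst (asm) has_sum_swap) simp
  show "((\<lambda>y. case (k, y) of (k, y) \<Rightarrow> real k * (real k * G x y * l k y)) has_sum real k * B k) S" for k
    unfolding B_def prod.case by (rule has_sum_cmult_right[OF has_sum_infsum[OF partner_weight_summable]])
qed

lemma partner_rate_nonneg: "0 \<le> B k"
  unfolding B_def by (rule infsum_nonneg) (rule partner_weight_nonneg)

lemma second_moment_density_nonneg: "0 \<le> A j"
  using x l_nonneg[of j x] unfolding A_def by (cases j) auto

text \<open>Exchange of the two summations in the loss rate; the index 0, absent on the left,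
  contributes nothing on the right.\<close>

lemma partner_rate_total: "(\<Sum>\<^sub>\<infinity>y\<in>S. \<Sum>\<^sub>\<infinity>j\<in>{1..}. real j * G x y * l j y) = infsum B UNIV"
proof -
  have "(\<lambda>(y, k). real k * G x y * l k y) summable_on S \<times> UNIV"
    by (rule summable_on_comparison_test[OF has_sum_imp_summable[OF weighted_second_moment]])
       (auto simp: partner_weight_le partner_weight_nonneg)
  then have "(\<Sum>\<^sub>\<infinity>y\<in>S. \<Sum>\<^sub>\<infinity>k. real k * G x y * l k y) = infsum B UNIV"
    unfolding B_def by (rule infsum_swap_banach)
  moreover have "(\<Sum>\<^sub>\<infinity>j\<in>{1..}. real j * G x y * l j y) = (\<Sum>\<^sub>\<infinity>k. real k * G x y * l k y)" for y
    by (rule infsum_cong_neutral) (auto simp: not_le)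
  ultimately show ?thesis
    by simp
qed

text \<open>The factor \<open>i\<close> cancels the denominator of \<open>j / i\<close>, leaving j^2
  (i - j) in the gain, and completes i^2 in the loss. The finite sum over \<open>j\<close> is pulled
  out of the sum over \<open>y\<close>.\<close>

lemma coag_rhs_eq:
  assumes "1 \<le> i"
  shows "real i * coag_rhs S G l i x = (\<Sum>j\<in>{1..<i}. A j * B (i - j)) - A i * infsum B UNIV"
proof -
  have "((\<lambda>y. \<Sum>j\<in>{1..<i}. A j / real i * (real (i - j) * G x y * l (i - j) y)) has_sum
      (\<Sum>j\<in>{1..<i}. A j / real i * B (i - j))) S"
    unfolding B_def
    by (intro has_sum_finite_sum has_sum_cmult_right has_sum_infsum partner_weight_summable) auto
  moreover have "(\<Sum>j\<in>{1..<i}. A j / real i * (real (i - j) * G x y * l (i - j) y)) =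
      (\<Sum>j\<in>{1..<i}. (real j / real i) * (real j * real (i - j)) * G x y * l j x * l (i - j) y)" for y
    by (intro sum.cong) (auto simp: A_def power2_eq_square)
  ultimately have "(\<Sum>\<^sub>\<infinity>y\<in>S. \<Sum>j\<in>{1..<i}.
      (real j / real i) * (real j * real (i - j)) * G x y * l j x * l (i - j) y) =
      (\<Sum>j\<in>{1..<i}. A j * B (i - j)) / real i"
    by (simp add: infsumI sum_divide_distrib)
  then show ?thesis
    using assms unfolding coag_rhs_def partner_rate_total
    by (simp add: A_def field_simps power2_eq_square)
qed

text \<open>The total of \<open>A\<close> is \<open>\<mu> x\<close>, and the first moment of
  \<open>B\<close> is the kernel applied to \<open>\<mu>\<close>. Bound and limit thus involve
  second moments only.\<close>

lemma second_moment_flux: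
  "\<bar>tent_flux A B n\<bar> \<le> \<mu> x * (\<Sum>\<^sub>\<infinity>y\<in>S. G x y * \<mu> y)"
  "tent_flux A B \<longlonglongrightarrow> \<mu> x * (\<Sum>\<^sub>\<infinity>y\<in>S. G x y * \<mu> y)"
proof -
  have A: "(A has_sum \<mu> x) UNIV"
    using \<mu>[OF x] unfolding A_def by (subst has_sum_atLeast_1_iff_UNIV[symmetric]) auto
  have zero: "A 0 = 0" "B 0 = 0"
    by (auto simp: A_def B_def)
  note rules = second_moment_density_nonneg partner_rate_nonneg zero has_sum_imp_summable[OF A] has_sum_imp_summable[OF partner_second_moment]
  show "\<bar>tent_flux A B n\<bar> \<le> \<mu> x * (\<Sum>\<^sub>\<infinity>y\<in>S. G x y * \<mu> y)"
    using tent_flux_bound[OF rules] infsumI[OF A] infsumI[OF partner_second_moment] by simp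
  show "tent_flux A B \<longlonglongrightarrow> \<mu> x * (\<Sum>\<^sub>\<infinity>y\<in>S. G x y * \<mu> y)"
    using tent_flux_tendsto[OF rules] infsumI[OF A] infsumI[OF partner_second_moment] by simp
qed

end

subsection \<open>Replicator dynamics of the second moments\<close>

locale bounded_kernel =
  fixes S :: "'s set" and G :: "'s \<Rightarrow> 's \<Rightarrow> real" and C :: real
  assumes G_nonneg: "\<And>x y. x \<in> S \<Longrightarrow> y \<in> S \<Longrightarrow> 0 \<le> G x y"
    and G_le: "\<And>x y. x \<in> S \<Longrightarrow> y \<in> S \<Longrightarrow> G x y \<le> C"
    and C_nonneg: "0 \<le> C"
begin

context
  fixes q :: "'s \<Rightarrow> real"
  assumes q_nonneg: "\<And>x. x \<in> S \<Longrightarrow> 0 \<le> q x" and q_summable: "q summable_on S"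
begin

lemma kernel_app_has_sum:
  assumes "x \<in> S"
  shows "((\<lambda>y. G x y * q y) has_sum kernel_app S G q x) S"
  unfolding kernel_app_def
  by (intro has_sum_infsum summable_on_comparison_test[OF summable_on_cmult_right[OF q_summable, of C]])
     (auto intro!: mult_right_mono mult_nonneg_nonneg simp: assms q_nonneg G_nonneg G_le)

lemma kernel_app_nonneg: "x \<in> S \<Longrightarrow> 0 \<le> kernel_app S G q x"
  unfolding kernel_app_def by (intro infsum_nonneg mult_nonneg_nonneg G_nonneg q_nonneg)

lemma kernel_app_le: "x \<in> S \<Longrightarrow> kernel_app S G q x \<le> C * infsum q S"
  by (rule has_sum_mono[OF kernel_app_has_sum has_sum_cmult_right[OF has_sum_infsum[OF q_summable]]])
     (auto intro: mult_right_mono simp: q_nonneg G_le)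

text \<open>Two weights are allowed because differentiating the quadratic form produces mixed
  products of a weight and its derivative.\<close>

lemma kernel_bilinear_has_sum:
  assumes r_nonneg: "\<And>x. x \<in> S \<Longrightarrow> 0 \<le> r x" and r_summable: "r summable_on S"
  shows "((\<lambda>(x, y). G x y * r x * q y) has_sum (\<Sum>\<^sub>\<infinity>x\<in>S. r x * kernel_app S G q x)) (S \<times> S)"
proof -
  have inner: "((\<lambda>y. G x y * r x * q y) has_sum r x * kernel_app S G q x) S" if "x \<in> S" for x
    using has_sum_cmult_right[OF kernel_app_has_sum[OF that], of "r x"] by (simp add: mult_ac)
  have outer: "(\<lambda>x. r x * kernel_app S G q x) summable_on S"
    by (rule summable_on_comparison_test[OF summable_on_cmult_left[OF r_summable, of "C * infsum q S"]])
       (auto intro: mult_left_mono simp: r_nonneg kernel_app_le kernel_app_nonneg)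
  show ?thesis
    by (rule has_sum_SigmaI[OF _ has_sum_infsum[OF outer] summable_on_SigmaI[OF _ outer]])
       (use inner in \<open>auto simp: G_nonneg r_nonneg q_nonneg\<close>)
qed

lemma kernel_form_has_sum:
  "((\<lambda>x. q x * kernel_app S G q x) has_sum kernel_form S G q) S"
proof (rule has_sum_SigmaD)
  show "((\<lambda>(x, y). G x y * q x * q y) has_sum kernel_form S G q) (S \<times> S)"
    unfolding kernel_form_def
    by (intro has_sum_infsum has_sum_imp_summable[OF kernel_bilinear_has_sum] q_nonneg q_summable)
  show "((\<lambda>y. case (x, y) of (x, y) \<Rightarrow> G x y * q x * q y) has_sum q x * kernel_app S G q x) S"
    if "x \<in> S" for x
    using has_sum_cmult_right[OF kernel_app_has_sum[OF that], of "q x"] by (simp add: mult_ac)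
qed

lemma kernel_form_le: "kernel_form S G q \<le> C * (infsum q S)\<^sup>2"
proof -
  have "kernel_form S G q \<le> infsum q S * (C * infsum q S)"
    by (rule has_sum_mono[OF kernel_form_has_sum has_sum_cmult_left[OF has_sum_infsum[OF q_summable]]])
       (auto intro: mult_left_mono simp: q_nonneg kernel_app_le)
  then show ?thesis
    by (simp add: power2_eq_square mult_ac)
qed

end

end

lemma kernel_app_divide: "kernel_app S G (\<lambda>x. q x / c) x = kernel_app S G q x / c"
  unfolding kernel_app_def divide_inverse by (simp add: mult.assoc[symmetric] infsum_cmult_left')

lemma kernel_form_divide: "kernel_form S G (\<lambda>x. q x / c) = kernel_form S G q / c\<^sup>2"
proof -
  have "(\<lambda>(x, y). G x y * (q x / c) * (q y / c)) =
      (\<lambda>p. (case p of (x, y) \<Rightarrow> G x y * q x * q y) * inverse (c\<^sup>2))"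
    by (auto simp: power2_eq_square divide_inverse)
  then show ?thesis
    unfolding kernel_form_def by (simp add: infsum_cmult_left' divide_inverse)
qed

section \<open>The closed system for the second moments\<close>

text \<open>The evolution is assumed in integrated form, since continuity of the integrand only
  follows from it below. \<open>I\<close> plays the part of the half-open interval up to gelation:
  each \<open>t\<close> lies strictly below some \<open>T\<close> in \<open>I\<close>, so local
  constants can be taken from the values at \<open>T\<close>.\<close>

locale moment_system = bounded_kernel S G C
  for S :: "'s set" and G :: "'s \<Rightarrow> 's \<Rightarrow> real" and C :: real +
  fixes m :: "'s \<Rightarrow> real \<Rightarrow> real" and I :: "real set"
  assumes G_sym: "\<And>x y. x \<in> S \<Longrightarrow> y \<in> S \<Longrightarrow> G x y = G y x"
    and interval_I: "is_interval I" and zero_in_I: "0 \<in> I"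
    and I_nonneg: "\<And>t. t \<in> I \<Longrightarrow> 0 \<le> t" and I_no_max: "\<And>t. t \<in> I \<Longrightarrow> \<exists>T\<in>I. t < T"
    and m_nonneg: "\<And>t x. t \<in> I \<Longrightarrow> x \<in> S \<Longrightarrow> 0 \<le> m x t"
    and m_summable: "\<And>t. t \<in> I \<Longrightarrow> (\<lambda>x. m x t) summable_on S"
    and initial_mass_pos: "0 < (\<Sum>\<^sub>\<infinity>x\<in>S. m x 0)"
    and m_integral: "\<And>t x. t \<in> I \<Longrightarrow> x \<in> S \<Longrightarrow>
      ((\<lambda>s. m x s * kernel_app S G (\<lambda>y. m y s) x) has_integral m x t - m x 0) {0..t}"
begin

abbreviation M :: "real \<Rightarrow> real" where
  "M t \<equiv> (\<Sum>\<^sub>\<infinity>x\<in>S. m x t)"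

abbreviation K :: "'s \<Rightarrow> real \<Rightarrow> real" where
  "K x t \<equiv> kernel_app S G (\<lambda>y. m y t) x"

abbreviation F :: "real \<Rightarrow> real" where
  "F t \<equiv> kernel_form S G (\<lambda>x. m x t)"

lemma I_sub: "t \<in> I \<Longrightarrow> {0..t} \<subseteq> I"
  using mem_is_interval_1_I[OF interval_I zero_in_I] by auto

lemma at_within_I:
  assumes "t \<in> I" "T \<in> I" "t < T"
  shows "at t within I = at t within {0..T}"
  by (rule at_within_nhd[of _ "{..<T}"]) (use assms I_nonneg I_sub[of T] in auto)

lemma K_nonneg: "t \<in> I \<Longrightarrow> x \<in> S \<Longrightarrow> 0 \<le> K x t"
  by (intro kernel_app_nonneg m_nonneg m_summable)

lemma K_le: "t \<in> I \<Longrightarrow> x \<in> S \<Longrightarrow> K x t \<le> C * M t"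
  by (intro kernel_app_le m_nonneg m_summable)

lemma m_integral_between:
  assumes "s \<in> I" "t \<in> I" "s \<le> t" "x \<in> S"
  shows "((\<lambda>u. m x u * K x u) has_integral m x t - m x s) {s..t}"
proof -
  have "(\<lambda>u. m x u * K x u) integrable_on {0..t}"
    using m_integral[OF assms(2,4)] by blast
  moreover from this have "(\<lambda>u. m x u * K x u) integrable_on {s..t}"
    by (rule integrable_on_subinterval) (use I_nonneg[OF \<open>s \<in> I\<close>] in auto)
  ultimately show ?thesis
    using Henstock_Kurzweil_Integration.integral_combine[of 0 s t "\<lambda>u. m x u * K x u"]
      I_nonneg[OF \<open>s \<in> I\<close>] \<open>s \<le> t\<close>
      m_integral[OF assms(1,4)] m_integral[OF assms(2,4)]
    by (auto simp: has_integral_iff)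
qed

lemma m_mono:
  assumes "s \<in> I" "t \<in> I" "s \<le> t" "x \<in> S"
  shows "m x s \<le> m x t"
proof -
  have "0 \<le> m x t - m x s"
    by (rule has_integral_nonneg[OF m_integral_between[OF assms]])
       (use assms I_sub[of t] I_nonneg[of s] in \<open>auto intro!: mult_nonneg_nonneg m_nonneg K_nonneg\<close>)
  then show ?thesis
    by simp
qed

lemma M_mono: "s \<in> I \<Longrightarrow> t \<in> I \<Longrightarrow> s \<le> t \<Longrightarrow> M s \<le> M t"
  by (intro infsum_mono m_summable m_mono)

lemma M_ge: "t \<in> I \<Longrightarrow> M 0 \<le> M t"
  using M_mono zero_in_I I_nonneg by blast

lemma M_pos: "t \<in> I \<Longrightarrow> 0 < M t"
  using M_ge initial_mass_pos by fastforce

text \<open>Both factors are controlled by monotonicity up to \<open>T\<close>. The resulting bound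
  is free of \<open>s\<close> and summable in \<open>x\<close>, so it serves as Lipschitz constant
  and as majorant for termwise differentiation.\<close>

lemma rate_le:
  assumes "s \<in> I" "T \<in> I" "s \<le> T" "x \<in> S"
  shows "m x s * K x s \<le> m x T * (C * M T)"
proof -
  have "K x s \<le> C * M T"
    using K_le[OF assms(1,4)] mult_left_mono[OF M_mono[OF assms(1-3)] C_nonneg] by linarith
  then show ?thesis
    by (intro mult_mono m_mono assms K_nonneg m_nonneg)
qed

lemma m_lipschitz:
  assumes "s \<in> I" "t \<in> I" "T \<in> I" "s \<le> t" "t \<le> T" "x \<in> S"
  shows "m x t - m x s \<le> m x T * (C * M T) * (t - s)"
proof (rule has_integral_le[OF m_integral_between])
  show "((\<lambda>_. m x T * (C * M T)) has_integral m x T * (C * M T) * (t - s)) {s..t}"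
    using has_integral_const_real[of "m x T * (C * M T)" s t] \<open>s \<le> t\<close> by (simp add: mult_ac)
  show "m x u * K x u \<le> m x T * (C * M T)" if "u \<in> {s..t}" for u
    by (rule rate_le) (use that assms I_sub[of t] I_nonneg[of s] in auto)
qed (use assms in auto)

lemma m_diff_has_sum:
  "s \<in> I \<Longrightarrow> t \<in> I \<Longrightarrow> ((\<lambda>x. m x t - m x s) has_sum M t - M s) S"
  using has_sum_add[OF has_sum_infsum[OF m_summable] has_sum_uminusI[OF has_sum_infsum[OF m_summable]]]
  by simp

lemma M_lipschitz:
  assumes "s \<in> I" "t \<in> I" "T \<in> I" "s \<le> t" "t \<le> T"
  shows "M t - M s \<le> M T * (C * M T) * (t - s)"
proof -
  have "((\<lambda>x. m x T * (C * M T) * (t - s)) has_sum M T * (C * M T) * (t - s)) S"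
    by (intro has_sum_cmult_left has_sum_infsum m_summable assms)
  then show ?thesis
    by (intro has_sum_mono[OF m_diff_has_sum]) (use assms m_lipschitz in auto)
qed

text \<open>By linearity the difference is the kernel applied to the increments of \<open>m\<close>,
  which are nonnegative by monotonicity.\<close>

lemma K_diff:
  assumes "s \<in> I" "t \<in> I" "s \<le> t" "x \<in> S"
  shows "0 \<le> K x t - K x s" "K x t - K x s \<le> C * (M t - M s)"
proof -
  have sum: "((\<lambda>y. G x y * (m y t - m y s)) has_sum K x t - K x s) S"
    using has_sum_add[OF kernel_app_has_sum has_sum_uminusI[OF kernel_app_has_sum],
        of "\<lambda>y. m y t" x "\<lambda>y. m y s" x] assms
    by (simp add: m_nonneg m_summable algebra_simps)
  show "0 \<le> K x t - K x s"
    using sum by (rule has_sum_nonneg) (use assms m_mono in \<open>auto simp: G_nonneg\<close>)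
  show "K x t - K x s \<le> C * (M t - M s)"
    by (rule has_sum_mono[OF sum has_sum_cmult_right[OF m_diff_has_sum]])
       (use assms m_mono in \<open>auto intro: mult_right_mono simp: G_le\<close>)
qed

lemma locally_lipschitz_imp_continuous:
  fixes f L :: "real \<Rightarrow> real"
  assumes "\<And>s t T. s \<in> I \<Longrightarrow> t \<in> I \<Longrightarrow> T \<in> I \<Longrightarrow> s \<le> t \<Longrightarrow> t \<le> T \<Longrightarrow> \<bar>f t - f s\<bar> \<le> L T * (t - s)"
  shows "continuous_on I f"
  unfolding continuous_on_def
proof
  fix t assume t: "t \<in> I"
  \<comment> \<open>With \<open>T\<close> strictly above \<open>t\<close>, the interval
    \<open>{0..T}\<close> contains all points of \<open>I\<close> near \<open>t\<close>, so the
    single constant \<open>L T\<close> suffices on both sides.\<close>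
  obtain T where T: "T \<in> I" "t < T"
    using I_no_max t by blast
  have bound: "\<bar>f u - f t\<bar> \<le> L T * \<bar>u - t\<bar>" if "u \<in> {0..T}" for u
  proof -
    have "u \<in> I"
      using that I_sub[OF T(1)] by auto
    then show ?thesis
      using assms[of u t T] assms[of t u T] t T that by (cases "u \<le> t") (auto simp: abs_minus_commute)
  qed
  have "((\<lambda>u. \<bar>f u - f t\<bar>) \<longlongrightarrow> 0) (at t within {0..T})"
  proof (rule tendsto_sandwich[where f = "\<lambda>_. 0"])
    show "\<forall>\<^sub>F u in at t within {0..T}. \<bar>f u - f t\<bar> \<le> L T * \<bar>u - t\<bar>"
      unfolding eventually_at_filter using bound by (intro always_eventually) auto
    have "((\<lambda>u. L T * \<bar>u - t\<bar>) \<longlongrightarrow> L T * \<bar>t - t\<bar>) (at t within {0..T})"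
      by (intro tendsto_intros)
    then show "((\<lambda>u. L T * \<bar>u - t\<bar>) \<longlongrightarrow> 0) (at t within {0..T})"
      by simp
  qed auto
  then show "(f \<longlongrightarrow> f t) (at t within I)"
    unfolding at_within_I[OF t T] by (metis LIM_zero_cancel tendsto_rabs_zero_iff)
qed

lemma M_continuous: "continuous_on I M"
  by (rule locally_lipschitz_imp_continuous[of _ "\<lambda>T. M T * (C * M T)"])
     (use M_lipschitz M_mono in auto)

lemma m_continuous: "x \<in> S \<Longrightarrow> continuous_on I (m x)"
  by (rule locally_lipschitz_imp_continuous[of _ "\<lambda>T. m x T * (C * M T)"])
     (use m_lipschitz m_mono in auto)

lemma K_continuous:
  assumes x: "x \<in> S"
  shows "continuous_on I (K x)"
proof (rule locally_lipschitz_imp_continuous)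
  fix s t T assume st: "s \<in> I" "t \<in> I" "T \<in> I" "s \<le> t" "t \<le> T"
  show "\<bar>K x t - K x s\<bar> \<le> C * (M T * (C * M T)) * (t - s)"
    using K_diff[OF st(1,2,4) x] mult_left_mono[OF M_lipschitz[OF st] C_nonneg] by (simp add: mult_ac)
qed

lemma has_real_derivative_integral_I:
  assumes f: "continuous_on I f" and "t \<in> I"
  shows "((\<lambda>s. integral {0..s} f) has_real_derivative f t) (at t within I)"
proof -
  obtain T where T: "T \<in> I" "t < T"
    using I_no_max \<open>t \<in> I\<close> by blast
  show ?thesis
    unfolding at_within_I[OF \<open>t \<in> I\<close> T]
    by (rule integral_has_real_derivative)
       (use T \<open>t \<in> I\<close> I_nonneg I_sub f in \<open>auto intro: continuous_on_subset\<close>)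
qed

text \<open>The integrand has just been shown continuous, so the integral equation can be
  differentiated.\<close>

lemma m_deriv:
  assumes "x \<in> S" "t \<in> I"
  shows "(m x has_real_derivative m x t * K x t) (at t within I)"
proof -
  have "((\<lambda>s. m x 0 + integral {0..s} (\<lambda>u. m x u * K x u)) has_real_derivative 0 + m x t * K x t)
      (at t within I)"
    using assms
    by (intro DERIV_add DERIV_const has_real_derivative_integral_I continuous_on_mult m_continuous K_continuous)
  moreover have "m x 0 + integral {0..s} (\<lambda>u. m x u * K x u) = m x s" if "s \<in> I" for s
    using m_integral[OF that assms(1)] by (simp add: has_integral_iff)
  ultimately show ?thesis
    using assms by (simp add: has_field_derivative_transform_within[where d = 1])
qed

lemma m_deriv_compact:
  assumes "x \<in> S" "T \<in> I" "s \<in> {0..T}"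
  shows "(m x has_real_derivative m x s * K x s) (at s within {0..T})"
  by (rule DERIV_subset[OF m_deriv]) (use assms I_sub in blast)+

text \<open>The majorant \<open>g T\<close> may grow with \<open>T\<close>; at a given
  \<open>t\<close> only one compact interval reaching beyond \<open>t\<close> is used.\<close>

lemma has_real_derivative_infsum_I:
  fixes f f' :: "'a \<Rightarrow> real \<Rightarrow> real" and g :: "real \<Rightarrow> 'a \<Rightarrow> real"
  assumes t: "t \<in> I"
    and deriv: "\<And>i s T. i \<in> A \<Longrightarrow> T \<in> I \<Longrightarrow> s \<in> {0..T} \<Longrightarrow>
      (f i has_real_derivative f' i s) (at s within {0..T})"
    and bound: "\<And>i s T. i \<in> A \<Longrightarrow> T \<in> I \<Longrightarrow> s \<in> {0..T} \<Longrightarrow> s \<in> I \<Longrightarrow> \<bar>f' i s\<bar> \<le> g T i"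
    and summable: "\<And>s. s \<in> I \<Longrightarrow> (\<lambda>i. f i s) summable_on A" "\<And>T. T \<in> I \<Longrightarrow> g T summable_on A"
  shows "((\<lambda>s. \<Sum>\<^sub>\<infinity>i\<in>A. f i s) has_real_derivative (\<Sum>\<^sub>\<infinity>i\<in>A. f' i t)) (at t within I)"
proof -
  obtain T where T: "T \<in> I" "t < T"
    using I_no_max t by blast
  show ?thesis
    unfolding at_within_I[OF t T]
    by (rule has_real_derivative_infsum[where g = "g T"])
       (use T t deriv bound summable I_sub[OF T(1)] I_nonneg[OF t] in auto)
qed

lemma M_deriv:
  assumes t: "t \<in> I"
  shows "(M has_real_derivative F t) (at t within I)"
proof -
  have "(M has_real_derivative (\<Sum>\<^sub>\<infinity>x\<in>S. m x t * K x t)) (at t within I)"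
  proof (rule has_real_derivative_infsum_I[OF t, where g = "\<lambda>T x. m x T * (C * M T)"])
    show "\<bar>m x s * K x s\<bar> \<le> m x T * (C * M T)" if "x \<in> S" "T \<in> I" "s \<in> {0..T}" "s \<in> I" for x s T
      using rate_le[of s T x] that m_nonneg K_nonneg by auto
  qed (auto intro!: summable_on_cmult_left m_summable m_deriv_compact)
  then show ?thesis
    using infsumI[OF kernel_form_has_sum[of "\<lambda>x. m x t"]] t by (simp add: m_nonneg m_summable)
qed

lemma rate_summable:
  assumes t: "t \<in> I"
  shows "(\<lambda>x. m x t * K x t) summable_on S" "(\<lambda>x. m x t * K x t * K x t) summable_on S"
proof -
  show 1: "(\<lambda>x. m x t * K x t) summable_on S"
    by (rule summable_on_comparison_test[OF summable_on_cmult_left[OF m_summable[OF t], of "C * M t"]])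
       (use t in \<open>auto intro!: mult_left_mono mult_nonneg_nonneg K_le K_nonneg m_nonneg\<close>)
  show "(\<lambda>x. m x t * K x t * K x t) summable_on S"
    by (rule summable_on_comparison_test[OF summable_on_cmult_left[OF 1, of "C * M t"]])
       (use t in \<open>auto intro!: mult_left_mono mult_nonneg_nonneg K_le K_nonneg m_nonneg\<close>)
qed

text \<open>The product rule gives two double sums, one differentiating each copy of
  \<open>m\<close>. Exchanging \<open>x\<close> and \<open>y\<close> and using the symmetry of
  \<open>G\<close> shows that they are equal, whence the factor 2.\<close>

lemma F_deriv:
  assumes t: "t \<in> I"
  shows "(F has_real_derivative 2 * (\<Sum>\<^sub>\<infinity>x\<in>S. m x t * K x t * K x t)) (at t within I)"
proof -
  define f' where "f' = (\<lambda>p s. case p of (x, y) \<Rightarrow>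
    G x y * (m x s * K x s) * m y s + G x y * m x s * (m y s * K y s))"
  let ?R = "\<Sum>\<^sub>\<infinity>x\<in>S. m x t * K x t * K x t"
  have "((\<lambda>s. \<Sum>\<^sub>\<infinity>p\<in>S \<times> S. (\<lambda>(x, y) s. G x y * m x s * m y s) p s) has_real_derivative
      (\<Sum>\<^sub>\<infinity>p\<in>S \<times> S. f' p t)) (at t within I)"
  \<comment> \<open>Each of the two product-rule terms is at most
    \<open>C * (C * M T) * (m x T * m y T)\<close>.\<close>
  proof (rule has_real_derivative_infsum_I[OF t,
        where g = "\<lambda>T (x, y). 2 * C * (C * M T) * (m x T * m y T)"])
    show "((\<lambda>(x, y) s. G x y * m x s * m y s) p has_real_derivative f' p s) (at s within {0..T})"
      if "p \<in> S \<times> S" "T \<in> I" "s \<in> {0..T}" for p s T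
      using that unfolding f'_def
      by (auto intro!: derivative_eq_intros m_deriv_compact simp: algebra_simps)
  next
    fix p s T assume p: "p \<in> S \<times> S" and T: "T \<in> I" "s \<in> {0..T}" "s \<in> I"
    obtain x y where xy: "p = (x, y)" "x \<in> S" "y \<in> S"
      using p by blast
    have "s \<le> T"
      using T by auto
    note nonneg = G_nonneg m_nonneg K_nonneg C_nonneg mult_nonneg_nonneg less_imp_le[OF M_pos]
    have "G x y * (m x s * K x s) * m y s \<le> C * (m x T * (C * M T)) * m y T"
      by (intro mult_mono rate_le m_mono G_le nonneg) (use xy T \<open>s \<le> T\<close> in auto)
    moreover have "G x y * m x s * (m y s * K y s) \<le> C * m x T * (m y T * (C * M T))"
      by (intro mult_mono rate_le m_mono G_le nonneg) (use xy T \<open>s \<le> T\<close> in auto)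
    moreover have "0 \<le> f' p s"
      unfolding f'_def xy prod.case by (intro add_nonneg_nonneg nonneg xy T)
    ultimately show "\<bar>f' p s\<bar> \<le> (case p of (x, y) \<Rightarrow> 2 * C * (C * M T) * (m x T * m y T))"
      unfolding f'_def xy prod.case by (simp add: algebra_simps)
  next
    show "(\<lambda>p. (\<lambda>(x, y) s. G x y * m x s * m y s) p s) summable_on S \<times> S" if "s \<in> I" for s
      using has_sum_imp_summable[OF kernel_bilinear_has_sum[of "\<lambda>x. m x s" "\<lambda>x. m x s"]] that
      by (simp add: m_nonneg m_summable case_prod_unfold)
    show "(\<lambda>(x, y). 2 * C * (C * M T) * (m x T * m y T)) summable_on S \<times> S" if T: "T \<in> I" for T
      using summable_on_cmult_right[OF has_sum_imp_summable[OF has_sum_times_nonneg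
            [OF has_sum_infsum[OF m_summable[OF T]] has_sum_infsum[OF m_summable[OF T]]]],
          of "2 * C * (C * M T)"] T
      by (simp add: m_nonneg case_prod_unfold)
  qed
  moreover have "((\<lambda>p. f' p t) has_sum ?R + ?R) (S \<times> S)"
  proof -
    have 1: "((\<lambda>(x, y). G x y * (m x t * K x t) * m y t) has_sum ?R) (S \<times> S)"
      using t by (intro kernel_bilinear_has_sum m_nonneg m_summable rate_summable
          mult_nonneg_nonneg K_nonneg)
    have "((\<lambda>(x, y). G y x * (m y t * K y t) * m x t) has_sum ?R) (S \<times> S)"
      using 1 by (subst (asm) has_sum_swap) simp
    then have "((\<lambda>(x, y). G x y * m x t * (m y t * K y t)) has_sum ?R) (S \<times> S)"
      by (rule has_sum_cong[THEN iffD1, rotated]) (auto simp: mult_ac G_sym)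
    from has_sum_add[OF 1 this] show ?thesis
      by (simp add: f'_def case_prod_unfold)
  qed
  ultimately show ?thesis
    by (simp add: kernel_form_def case_prod_unfold infsumI)
qed

text \<open>The variance of \<open>K\<close> under the weights \<open>m / M\<close> is nonnegative.\<close>

lemma F_squared_le:
  assumes t: "t \<in> I"
  shows "(F t)\<^sup>2 \<le> M t * (\<Sum>\<^sub>\<infinity>x\<in>S. m x t * K x t * K x t)"
proof -
  let ?R = "\<Sum>\<^sub>\<infinity>x\<in>S. m x t * K x t * K x t" and ?c = "F t / M t"
  have "((\<lambda>x. m x t * K x t) has_sum F t) S"
    using t by (intro kernel_form_has_sum m_nonneg m_summable)
  then have "((\<lambda>x. m x t * K x t * K x t + (- 2 * ?c) * (m x t * K x t) + ?c\<^sup>2 * m x t) has_sum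
      ?R + (- 2 * ?c) * F t + ?c\<^sup>2 * M t) S"
    using t by (intro has_sum_add has_sum_cmult_right has_sum_infsum rate_summable m_summable)
  moreover have "m x t * K x t * K x t + (- 2 * ?c) * (m x t * K x t) + ?c\<^sup>2 * m x t =
      m x t * (K x t - ?c)\<^sup>2" for x
    by (simp add: power2_eq_square algebra_simps)
  ultimately have "((\<lambda>x. m x t * (K x t - ?c)\<^sup>2) has_sum ?R + (- 2 * ?c) * F t + ?c\<^sup>2 * M t) S"
    by (simp only:)
  then have "0 \<le> ?R + (- 2 * ?c) * F t + ?c\<^sup>2 * M t"
    by (rule has_sum_nonneg) (use t m_nonneg in auto)
  also have "\<dots> = ?R - (F t)\<^sup>2 / M t"
    using M_pos[OF t] by (simp add: field_simps power2_eq_square)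
  finally show ?thesis
    using M_pos[OF t] by (simp add: field_simps)
qed

text \<open>This is \<alpha>(t) for the profile \<open>m / M\<close>, the average of the fitness
  \<open>kernel_app\<close> under that profile.\<close>

definition mean_fitness :: "real \<Rightarrow> real" where
  "mean_fitness t = kernel_form S G (\<lambda>x. m x t / M t)"

lemma mean_fitness_eq: "mean_fitness t = F t / (M t)\<^sup>2"
  by (simp add: mean_fitness_def kernel_form_divide)

text \<open>The quotient rule gives 2 (M R - F^2) / M^3 with R the sum of m K^2, which is
  nonnegative by \<open>F_squared_le\<close>.\<close>

lemma mean_fitness_mono: "mono_on I mean_fitness"
proof (rule has_real_derivative_nonneg_imp_mono_on[OF interval_I])
  fix t assume t: "t \<in> I"
  let ?R = "\<Sum>\<^sub>\<infinity>x\<in>S. m x t * K x t * K x t"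
  have "((\<lambda>t. F t / (M t)\<^sup>2) has_real_derivative
      (2 * ?R * (M t)\<^sup>2 - F t * (2 * M t * F t)) / ((M t)\<^sup>2 * (M t)\<^sup>2)) (at t within I)"
    using M_pos[OF t]
    by (intro DERIV_divide F_deriv t) (auto intro!: derivative_eq_intros M_deriv t)
  then show "(mean_fitness has_real_derivative
      (2 * ?R * (M t)\<^sup>2 - F t * (2 * M t * F t)) / ((M t)\<^sup>2 * (M t)\<^sup>2)) (at t within I)"
    by (simp add: mean_fitness_eq[abs_def])
  have "2 * ?R * (M t)\<^sup>2 - F t * (2 * M t * F t) = 2 * M t * (M t * ?R - (F t)\<^sup>2)"
    by (simp add: power2_eq_square algebra_simps)
  also have "\<dots> \<ge> 0"
    using F_squared_le[OF t] M_pos[OF t] by simp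
  finally show "0 \<le> (2 * ?R * (M t)\<^sup>2 - F t * (2 * M t * F t)) / ((M t)\<^sup>2 * (M t)\<^sup>2)"
    by simp
qed

text \<open>The leading factor \<open>M t\<close> is kept apart because it is the derivative of the
  rescaled time and will cancel.\<close>

lemma profile_deriv:
  assumes x: "x \<in> S" and t: "t \<in> I"
  shows "((\<lambda>t. m x t / M t) has_real_derivative
      M t * (m x t / M t * (kernel_app S G (\<lambda>y. m y t / M t) x - mean_fitness t))) (at t within I)"
proof -
  have "((\<lambda>t. m x t / M t) has_real_derivative
      (m x t * K x t * M t - m x t * F t) / (M t * M t)) (at t within I)"
    using M_pos[OF t] by (intro DERIV_divide m_deriv M_deriv x t) auto
  moreover have "(m x t * K x t * M t - m x t * F t) / (M t * M t) =
      M t * (m x t / M t * (kernel_app S G (\<lambda>y. m y t / M t) x - mean_fitness t))"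
    using M_pos[OF t] by (simp add: kernel_app_divide mean_fitness_eq field_simps power2_eq_square)
  ultimately show ?thesis
    by simp
qed

text \<open>Passing to the reciprocal turns the Riccati equation M' = \<alpha> M^2 into one that is
  integrated directly.\<close>

lemma inverse_M_deriv:
  assumes t: "t \<in> I"
  shows "((\<lambda>t. 1 / M t) has_real_derivative - mean_fitness t) (at t within I)"
  using M_pos[OF t]
  by (auto intro!: derivative_eq_intros M_deriv t simp: mean_fitness_eq power2_eq_square)

text \<open>The mean fitness never falls below its initial value, so \<open>1 / M\<close> decreases
  at least at that constant rate.\<close>

lemma inverse_M_le:
  assumes t: "t \<in> I"
  shows "1 / M t \<le> 1 / M 0 - mean_fitness 0 * t"
proof -
  have "mono_on I (\<lambda>s. - (1 / M s) - mean_fitness 0 * s)"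
  proof (rule has_real_derivative_nonneg_imp_mono_on[OF interval_I])
    fix s assume s: "s \<in> I"
    show "((\<lambda>s. - (1 / M s) - mean_fitness 0 * s) has_real_derivative - (- mean_fitness s) - mean_fitness 0) (at s within I)"
      by (intro DERIV_diff DERIV_minus inverse_M_deriv s) (auto intro!: derivative_eq_intros)
    show "0 \<le> - (- mean_fitness s) - mean_fitness 0"
      using mono_onD[OF mean_fitness_mono zero_in_I s] I_nonneg[OF s] by simp
  qed
  from mono_onD[OF this zero_in_I t] I_nonneg[OF t] show ?thesis
    by simp
qed

lemma inverse_M_ge:
  assumes t: "t \<in> I" and fitness_le: "\<And>s. s \<in> I \<Longrightarrow> mean_fitness s \<le> c"
  shows "1 / M 0 - c * t \<le> 1 / M t"
proof -
  have "mono_on I (\<lambda>s. 1 / M s + c * s)"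
  proof (rule has_real_derivative_nonneg_imp_mono_on[OF interval_I])
    fix s assume s: "s \<in> I"
    show "((\<lambda>s. 1 / M s + c * s) has_real_derivative - mean_fitness s + c) (at s within I)"
      by (intro DERIV_add inverse_M_deriv s) (auto intro!: derivative_eq_intros)
    show "0 \<le> - mean_fitness s + c"
      using fitness_le[OF s] by simp
  qed
  from mono_onD[OF this zero_in_I t] I_nonneg[OF t] show ?thesis
    by simp
qed

section \<open>Passage to the rescaled time\<close>

definition rescaled_time :: "real \<Rightarrow> real" where
  "rescaled_time t = integral {0..t} M"

lemma rescaled_time_deriv:
  "t \<in> I \<Longrightarrow> (rescaled_time has_real_derivative M t) (at t within I)"
  unfolding rescaled_time_def[abs_def] by (intro has_real_derivative_integral_I M_continuous)

text \<open>The derivative \<open>M\<close> is at least \<open>M 0\<close>, which is positive. This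
  supplies the expansion constant for differentiating along the inverse.\<close>

lemma rescaled_time_expand:
  assumes "s \<in> I" "t \<in> I" "s \<le> t"
  shows "M 0 * (t - s) \<le> rescaled_time t - rescaled_time s"
proof -
  have "mono_on I (\<lambda>s. rescaled_time s - M 0 * s)"
  proof (rule has_real_derivative_nonneg_imp_mono_on[OF interval_I])
    fix s assume s: "s \<in> I"
    show "((\<lambda>s. rescaled_time s - M 0 * s) has_real_derivative M s - M 0) (at s within I)"
      by (intro DERIV_diff rescaled_time_deriv s) (auto intro!: derivative_eq_intros)
    show "0 \<le> M s - M 0"
      using M_ge[OF s] by simp
  qed
  from mono_onD[OF this assms] show ?thesis
    by (simp add: algebra_simps)
qed

lemma rescaled_time_strict_mono: "strict_mono_on I rescaled_time"
proof (rule strict_mono_onI)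
  fix s t assume "s \<in> I" "t \<in> I" "s < t"
  then show "rescaled_time s < rescaled_time t"
    using rescaled_time_expand[of s t] mult_pos_pos[OF initial_mass_pos, of "t - s"] by simp
qed

lemma profile_replicator:
  assumes x: "x \<in> S" and t: "t \<in> I"
  shows "((\<lambda>u. (\<lambda>s. m x s / M s) (the_inv_into I rescaled_time u)) has_real_derivative
      m x t / M t * (kernel_app S G (\<lambda>y. m y t / M t) x - mean_fitness t))
      (at (rescaled_time t) within rescaled_time ` I)"
proof -
  have expand: "M 0 * \<bar>s - t\<bar> \<le> \<bar>rescaled_time s - rescaled_time t\<bar>" if "s \<in> I" "t \<in> I" for s t
    using rescaled_time_expand[of s t] rescaled_time_expand[of t s] that
    by (cases "s \<le> t") (auto simp: abs_minus_commute)
  show ?thesis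
    using has_real_derivative_the_inv_into[OF initial_mass_pos expand t _
        rescaled_time_deriv[OF t] profile_deriv[OF x t]] M_pos[OF t]
    by simp
qed

lemma mean_fitness_rescaled_mono: "mono_on (rescaled_time ` I) (\<lambda>u. mean_fitness (the_inv_into I rescaled_time u))"
proof (rule mono_onI)
  fix u v assume "u \<in> rescaled_time ` I" "v \<in> rescaled_time ` I" "u \<le> v"
  then obtain s t where st: "s \<in> I" "t \<in> I" "u = rescaled_time s" "v = rescaled_time t"
    by blast
  have inj: "inj_on rescaled_time I"
    using rescaled_time_strict_mono by (rule strict_mono_on_imp_inj_on)
  have "s \<le> t"
    using st \<open>u \<le> v\<close> strict_mono_onD[OF rescaled_time_strict_mono, of t s] by fastforce
  then show "mean_fitness (the_inv_into I rescaled_time u) \<le> mean_fitness (the_inv_into I rescaled_time v)"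
    using st mono_onD[OF mean_fitness_mono] by (simp add: the_inv_into_f_f[OF inj])
qed

end

subsection \<open>Solutions of the coagulation equation\<close>

locale coagulation = bounded_kernel S G C
  for S :: "'s set" and G :: "'s \<Rightarrow> 's \<Rightarrow> real" and C :: real +
  fixes lam :: "real \<Rightarrow> nat \<Rightarrow> 's \<Rightarrow> real"
  assumes kernel_sym: "\<And>x y. x \<in> S \<Longrightarrow> y \<in> S \<Longrightarrow> G x y = G y x"
    and solution: "coag_solution S G lam"
begin

abbreviation J :: "real set" where
  "J \<equiv> pregel_times S lam"

abbreviation m2 :: "'s \<Rightarrow> real \<Rightarrow> real" where
  "m2 x t \<equiv> enn2real (moment lam 2 x t)"

lemma J_interval: "is_interval J"
  unfolding is_interval_1 pregel_times_def by (auto intro: le_less_trans[rotated])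

lemma zero_in_J: "0 \<in> J"
  using solution by (simp add: coag_solution_def pregel_times_def zero_ereal_def)

lemma J_sub: "T \<in> J \<Longrightarrow> {0..T} \<subseteq> J"
  using mem_is_interval_1_I[OF J_interval zero_in_J] by auto

lemma J_no_max:
  assumes "t \<in> J"
  shows "\<exists>T\<in>J. t < T"
proof -
  obtain T where "ereal t < ereal T" "ereal T < gel_time S lam"
    using assms ereal_dense2 by (force simp: pregel_times_def)
  then show ?thesis
    using assms by (intro bexI[of _ T]) (auto simp: pregel_times_def)
qed

lemma lam_nonneg: "t \<in> J \<Longrightarrow> 1 \<le> i \<Longrightarrow> x \<in> S \<Longrightarrow> 0 \<le> lam t i x"
  using solution by (simp add: coag_solution_def)

lemma total_moment_bound:
  assumes "T \<in> J"
  obtains b where "0 \<le> b" "\<And>t. t \<in> {0..T} \<Longrightarrow> total_moment S lam 2 t \<le> ennreal b"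
proof -
  obtain b where "\<forall>t\<in>{0..T}. total_moment S lam 2 t \<le> ennreal b"
    using solution assms by (auto simp: coag_solution_def)
  \<comment> \<open>Negative reals are sent to 0 by \<open>ennreal\<close>, so
    \<open>max 0 b\<close> bounds the moment as well and can be used as a nonnegative
    factor.\<close>
  then show ?thesis
    using order_trans[OF _ ennreal_leI[of b "max 0 b"]] by (intro that[of "max 0 b"]) auto
qed

lemma total_moment_finite: "t \<in> J \<Longrightarrow> total_moment S lam 2 t < \<infinity>"
  using total_moment_bound[of t]
  by (metis atLeastAtMost_iff ennreal_less_top infinity_ennreal_def le_less_trans mem_Collect_eq
      order_refl pregel_times_def)

lemma m2_has_sum:
  "t \<in> J \<Longrightarrow> ((\<lambda>x. m2 x t) has_sum enn2real (total_moment S lam 2 t)) S"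
  using enn2real_infsum[of "\<lambda>x. moment lam 2 x t" S] total_moment_finite[of t]
  by (simp add: total_moment_def)

lemma total_moment_eq:
  assumes "t \<in> J"
  shows "enn2real (total_moment S lam 2 t) = (\<Sum>\<^sub>\<infinity>x\<in>S. m2 x t)"
    and "total_moment S lam 2 t = ennreal (\<Sum>\<^sub>\<infinity>x\<in>S. m2 x t)"
proof -
  show "enn2real (total_moment S lam 2 t) = (\<Sum>\<^sub>\<infinity>x\<in>S. m2 x t)"
    using infsumI[OF m2_has_sum[OF assms]] by simp
  then show "total_moment S lam 2 t = ennreal (\<Sum>\<^sub>\<infinity>x\<in>S. m2 x t)"
    using total_moment_finite[OF assms] by (metis ennreal_enn2real infinity_ennreal_def)
qed

lemma moment_finite:
  assumes "t \<in> J" "x \<in> S"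
  shows "moment lam 2 x t < \<infinity>"
proof -
  have "moment lam 2 x t = infsum (\<lambda>x. moment lam 2 x t) {x}"
    by simp
  also have "\<dots> \<le> total_moment S lam 2 t"
    unfolding total_moment_def
    by (rule infsum_mono_neutral) (use assms in \<open>auto intro: nonneg_summable_on_complete\<close>)
  finally show ?thesis
    using total_moment_finite[OF assms(1)] by (rule le_less_trans)
qed

lemma second_moment_has_sum:
  assumes "t \<in> J" "x \<in> S"
  shows "((\<lambda>i. real i ^ 2 * lam t i x) has_sum m2 x t) {1..}"
proof -
  have nonneg: "0 \<le> real i ^ 2 * lam t i x" if "i \<in> {1..}" for i
    using lam_nonneg assms that by simp
  have fin: "(\<Sum>\<^sub>\<infinity>i\<in>{1..}. ennreal (real i ^ 2 * lam t i x)) < \<infinity>"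
    using moment_finite[OF assms] by (simp add: moment_def)
  from infsum_ennreal_finite[OF nonneg fin] show ?thesis
    using infsum_nonneg[of "{1..}" "\<lambda>i. real i ^ 2 * lam t i x", OF nonneg] by (simp add: moment_def del: One_nat_def)
qed

lemma m2_summable: "t \<in> J \<Longrightarrow> (\<lambda>x. m2 x t) summable_on S"
  using m2_has_sum by (rule has_sum_imp_summable)

text \<open>The term \<open>i = 1\<close> alone contributes \<open>lam 0 1 x\<close>, and these add
  up to 1, so the initial second moment is at least 1.\<close>

lemma initial_m2_pos: "0 < (\<Sum>\<^sub>\<infinity>x\<in>S. m2 x 0)"
proof -
  have "lam 0 1 x \<le> m2 x 0" if "x \<in> S" for x
  proof -
    have "(\<Sum>i\<in>{1}. real i ^ 2 * lam 0 i x) \<le> m2 x 0"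
      by (rule finite_sum_le_has_sum[OF second_moment_has_sum[OF zero_in_J that]])
         (use lam_nonneg[OF zero_in_J] that in auto)
    then show ?thesis
      by simp
  qed
  moreover have "((\<lambda>x. lam 0 1 x) has_sum 1) S"
    using solution by (simp add: coag_solution_def)
  ultimately have "1 \<le> (\<Sum>\<^sub>\<infinity>x\<in>S. m2 x 0)"
    using has_sum_mono[OF _ has_sum_infsum[OF m2_summable[OF zero_in_J]]] by blast
  then show ?thesis
    by simp
qed

section \<open>Second moments as limits of truncated moments\<close>

text \<open>One of the two factors \<open>i\<close> in the second moment is replaced by the tent;
  what remains is a finite sum, to which the equation applies term by term.\<close>

definition tent_moment :: "nat \<Rightarrow> 's \<Rightarrow> real \<Rightarrow> real" where
  "tent_moment n x t = (\<Sum>i=1..2*n. tent n i * (real i * lam t i x))"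

lemma tent_moment_tendsto:
  assumes "t \<in> J" "x \<in> S"
  shows "(\<lambda>n. tent_moment n x t) \<longlonglongrightarrow> m2 x t"
proof -
  have "(\<lambda>n. \<Sum>\<^sub>\<infinity>i\<in>{1..}. tent n i * (real i * lam t i x)) \<longlonglongrightarrow>
      (\<Sum>\<^sub>\<infinity>i\<in>{1..}. real i ^ 2 * lam t i x)"
  proof (rule tendsto_infsum_dominated)
    show "(\<lambda>i. real i ^ 2 * lam t i x) summable_on {1..}"
      using second_moment_has_sum[OF assms] by (rule has_sum_imp_summable)
    have "norm (tent n i * (real i * lam t i x)) \<le> real i ^ 2 * lam t i x" if "i \<in> {1..}" for n i
      using mult_right_mono[OF tent_bounds(2)[of n i], of "real i * lam t i x"]
        lam_nonneg[of t i x] assms that tent_bounds(1)[of n i]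
      by (simp add: abs_mult power2_eq_square mult_ac)
    then show "\<forall>\<^sub>F n in sequentially. \<forall>i\<in>{1..}.
        norm (tent n i * (real i * lam t i x)) \<le> real i ^ 2 * lam t i x"
      by (intro always_eventually) auto
    show "(\<lambda>n. tent n i * (real i * lam t i x)) \<longlonglongrightarrow> real i ^ 2 * lam t i x" for i
      using tendsto_mult_right[OF tent_tendsto[of i], of "real i * lam t i x"]
      by (simp add: power2_eq_square mult_ac)
  qed simp
  moreover have "(\<Sum>\<^sub>\<infinity>i\<in>{1..}. tent n i * (real i * lam t i x)) = tent_moment n x t" for n
    unfolding tent_moment_def
    by (intro infsumI has_sum_finite_neutralI[of "{1..2*n}"]) (auto simp: tent_outside not_le)
  ultimately show ?thesis
    using infsumI[OF second_moment_has_sum[OF assms]] by simp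
qed

definition flux :: "nat \<Rightarrow> 's \<Rightarrow> real \<Rightarrow> real" where
  "flux n x t = tent_flux (\<lambda>j. real j ^ 2 * lam t j x)
     (\<lambda>k. \<Sum>\<^sub>\<infinity>y\<in>S. real k * G x y * lam t k y) n"

lemma flux_limit:
  assumes "t \<in> J" "x \<in> S"
  shows "\<bar>flux n x t\<bar> \<le> m2 x t * kernel_app S G (\<lambda>y. m2 y t) x"
    and "(\<lambda>n. flux n x t) \<longlonglongrightarrow> m2 x t * kernel_app S G (\<lambda>y. m2 y t) x"
  using second_moment_flux[of x S G C "lam t" "\<lambda>y. m2 y t"] assms
  by (auto simp: flux_def kernel_app_def G_nonneg G_le lam_nonneg second_moment_has_sum m2_summable
      simp del: One_nat_def)

lemma tent_moment_deriv:
  assumes "t \<in> J" "x \<in> S"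
  shows "(tent_moment n x has_real_derivative flux n x t) (at t within J)"
proof -
  have "((\<lambda>s. lam s i x) has_real_derivative coag_rhs S G (lam t) i x) (at t within J)" if "1 \<le> i" for i
    using solution assms that by (simp add: coag_solution_def)
  then have "(tent_moment n x has_real_derivative
      (\<Sum>i=1..2*n. tent n i * (real i * coag_rhs S G (lam t) i x))) (at t within J)"
    unfolding tent_moment_def[abs_def] by (intro DERIV_sum DERIV_cmult) auto
  moreover have "(\<Sum>i=1..2*n. tent n i * (real i * coag_rhs S G (lam t) i x)) = flux n x t"
    unfolding flux_def tent_flux_def
    by (intro sum.cong refl arg_cong[where f = "(*) _"] coag_rhs_eq[where C = C and \<mu> = "\<lambda>y. m2 y t"])
       (use assms in \<open>auto simp: G_nonneg G_le lam_nonneg second_moment_has_sum m2_summable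
         simp del: One_nat_def\<close>)
  ultimately show ?thesis
    by simp
qed

text \<open>The fundamental theorem of calculus holds for each truncated moment. Letting
  \<open>n\<close> grow, dominated convergence in time handles the flux and pointwise convergence
  handles the two boundary values.\<close>

lemma m2_integral:
  assumes T: "T \<in> J" and x: "x \<in> S"
  shows "((\<lambda>s. m2 x s * kernel_app S G (\<lambda>y. m2 y s) x) has_integral m2 x T - m2 x 0) {0..T}"
proof -
  let ?g = "\<lambda>s. m2 x s * kernel_app S G (\<lambda>y. m2 y s) x"
  have "0 \<le> T"
    using T by (simp add: pregel_times_def)
  have J: "s \<in> J" if "s \<in> {0..T}" for s
    using J_sub[OF T] that by auto
  have flux_integral: "(flux n x has_integral tent_moment n x T - tent_moment n x 0) {0..T}" for n
    by (rule fundamental_theorem_of_calculus[OF \<open>0 \<le> T\<close>])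
       (auto intro!: DERIV_subset[OF tent_moment_deriv] J J_sub T x
         simp: has_real_derivative_iff_has_vector_derivative[symmetric] simp del: atLeastAtMost_iff)
  obtain b where b: "0 \<le> b" "\<And>t. t \<in> {0..T} \<Longrightarrow> total_moment S lam 2 t \<le> ennreal b"
    using total_moment_bound[OF T] by blast
  \<comment> \<open>The constant is uniform in \<open>n\<close> and \<open>s\<close>:
    \<open>b\<close> bounds the total second moment on \<open>{0..T}\<close>, hence also
    \<open>m2 x s\<close>, and \<open>C * b\<close> bounds the kernel factor.\<close>
  have bound: "norm (flux n x s) \<le> b * (C * b)" if s: "s \<in> {0..T}" for n s
  proof -
    have M: "(\<Sum>\<^sub>\<infinity>y\<in>S. m2 y s) \<le> b"
      using b(2)[OF s] b(1) unfolding total_moment_eq(2)[OF J[OF s]] by simp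
    have "(\<Sum>y\<in>{x}. m2 y s) \<le> (\<Sum>\<^sub>\<infinity>y\<in>S. m2 y s)"
      by (rule finite_sum_le_infsum[OF m2_summable[OF J[OF s]]]) (use x in auto)
    then have "m2 x s \<le> b"
      using M by simp
    moreover have "kernel_app S G (\<lambda>y. m2 y s) x \<le> C * b"
      using kernel_app_le[of "\<lambda>y. m2 y s" x] mult_left_mono[OF M C_nonneg] m2_summable[OF J[OF s]] x
      by simp
    ultimately have "?g s \<le> b * (C * b)"
      using b(1) kernel_app_nonneg[of "\<lambda>y. m2 y s" x] m2_summable[OF J[OF s]] x
      by (intro mult_mono) auto
    then show ?thesis
      using flux_limit(1)[OF J[OF s] x, of n] by simp
  qed
  have conv: "(\<lambda>n. flux n x s) \<longlonglongrightarrow> ?g s" if "s \<in> {0..T}" for s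
    using flux_limit(2)[OF J[OF that] x] .
  have integrable: "flux n x integrable_on {0..T}" for n
    using flux_integral by blast
  note dct = dominated_convergence[OF integrable integrable_const_ivl bound conv]
  have "(\<lambda>n. integral {0..T} (flux n x)) \<longlonglongrightarrow> m2 x T - m2 x 0"
    unfolding integral_unique[OF flux_integral]
    by (intro tendsto_diff tent_moment_tendsto T x zero_in_J)
  then have "integral {0..T} ?g = m2 x T - m2 x 0"
    using dct(2) LIMSEQ_unique by blast
  then show ?thesis
    using dct(1) by (simp add: has_integral_iff)
qed

section \<open>The solution in rescaled time\<close>

sublocale moment_system S G C "\<lambda>x t. m2 x t" J
  by unfold_locales
     (use kernel_sym J_interval zero_in_J J_no_max m2_summable initial_m2_pos m2_integral in
       \<open>auto simp: pregel_times_def\<close>)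

lemma tau_eq: "t \<in> J \<Longrightarrow> tau S lam t = rescaled_time t"
  unfolding tau_def rescaled_time_def
  by (rule integral_cong) (use J_sub total_moment_eq(1) in blast)

text \<open>The two inverses agree even off the image, since \<open>the_inv_into\<close> consults
  the function only on \<open>J\<close>.\<close>

lemma orig_time_eq: "orig_time S lam = the_inv_into J rescaled_time"
  unfolding orig_time_def the_inv_into_def using tau_eq by (intro ext) (metis (no_types, lifting))

lemma tau_image: "tau S lam ` J = rescaled_time ` J"
  using tau_eq by (rule image_cong[OF refl])

lemma inj_on_rescaled_time: "inj_on rescaled_time J"
  using rescaled_time_strict_mono by (rule strict_mono_on_imp_inj_on)

lemma orig_time_rescaled: "t \<in> J \<Longrightarrow> orig_time S lam (rescaled_time t) = t"
  by (simp add: orig_time_eq the_inv_into_f_f[OF inj_on_rescaled_time])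

lemma prof_eq: "t \<in> J \<Longrightarrow> prof S lam t = (\<lambda>x. m2 x t / M t)"
  by (simp add: prof_def[abs_def] total_moment_eq(1))

lemma alpha_eq: "t \<in> J \<Longrightarrow> alpha S G lam t = mean_fitness t"
  by (simp add: alpha_def mean_fitness_def prof_eq)

lemma prof_resc_deriv:
  assumes x: "x \<in> S" and t: "t \<in> J"
  shows "((\<lambda>u. prof_resc S lam u x) has_real_derivative
      prof_resc S lam (tau S lam t) x *
        (kernel_app S G (prof_resc S lam (tau S lam t)) x - alpha_resc S G lam (tau S lam t)))
      (at (tau S lam t) within tau S lam ` J)"
proof -
  have "((\<lambda>u. prof_resc S lam u x) has_real_derivative
      m2 x t / M t * (kernel_app S G (\<lambda>y. m2 y t / M t) x - mean_fitness t))
      (at (rescaled_time t) within rescaled_time ` J)"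
  \<comment> \<open>The two functions of \<open>u\<close> are compared only on the image of
    \<open>J\<close>, which is all that a derivative within that image sees.\<close>
  proof (rule has_field_derivative_transform_within[OF profile_replicator[OF x t] zero_less_one])
    fix u assume "u \<in> rescaled_time ` J"
    then show "m2 x (the_inv_into J rescaled_time u) / M (the_inv_into J rescaled_time u) =
        prof_resc S lam u x"
      using orig_time_rescaled by (auto simp: prof_resc_def prof_eq orig_time_eq)
  qed (use t in auto)
  then show ?thesis
    using t by (simp add: tau_image tau_eq prof_resc_def alpha_resc_def orig_time_rescaled prof_eq alpha_eq)
qed

lemma alpha_resc_mono: "mono_on (tau S lam ` J) (alpha_resc S G lam)"
proof (rule mono_onI)
  fix u v assume "u \<in> tau S lam ` J" "v \<in> tau S lam ` J" "u \<le> v"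
  then show "alpha_resc S G lam u \<le> alpha_resc S G lam v"
    using mono_onD[OF mean_fitness_rescaled_mono, of u v] orig_time_rescaled
    by (auto simp: tau_image alpha_resc_def orig_time_eq alpha_eq)
qed

section \<open>Bounds on the gelation time\<close>

lemma alpha_max_finite: "alpha_max S G < \<infinity>"
proof -
  have "alpha_max S G \<le> ereal C"
    unfolding alpha_max_def
  proof (rule Sup_least, clarify)
    fix q :: "'s \<Rightarrow> real" assume q: "\<forall>x\<in>S. q x \<in> {0..1}" "(q has_sum 1) S"
    then have "kernel_form S G q \<le> C * (infsum q S)\<^sup>2"
      by (intro kernel_form_le) (auto intro: has_sum_imp_summable)
    then show "ereal (kernel_form S G q) \<le> ereal C"
      using infsumI[OF q(2)] by simp
  qed
  also have "ereal C < \<infinity>"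
    by simp
  finally show ?thesis .
qed

text \<open>The profile is itself a probability vector on \<open>S\<close>, hence admissible in the
  supremum.\<close>

lemma alpha_le_alpha_max:
  assumes t: "t \<in> J"
  shows "ereal (mean_fitness t) \<le> alpha_max S G"
  unfolding alpha_max_def
proof (rule Sup_upper, rule CollectI, intro exI conjI)
  show "ereal (mean_fitness t) = ereal (kernel_form S G (\<lambda>x. m2 x t / M t))"
    by (simp add: mean_fitness_def)
  show "\<forall>x\<in>S. m2 x t / M t \<in> {0..1}"
  proof
    fix x assume x: "x \<in> S"
    have "(\<Sum>y\<in>{x}. m2 y t) \<le> M t"
      by (rule finite_sum_le_infsum[OF m2_summable[OF t]]) (use x in auto)
    then show "m2 x t / M t \<in> {0..1}"
      using M_pos[OF t] by simp
  qed
  show "((\<lambda>x. m2 x t / M t) has_sum 1) S"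
    using has_sum_cmult_left[OF has_sum_infsum[OF m2_summable[OF t]], of "inverse (M t)"] M_pos[OF t]
    by (simp add: divide_inverse)
qed

text \<open>Some \<open>x\<close> has a positive initial second moment, and its diagonal term alone
  makes the form positive.\<close>

lemma alpha_0_pos:
  assumes "\<And>x. x \<in> S \<Longrightarrow> 0 < G x x"
  shows "0 < mean_fitness 0"
proof -
  obtain x where x: "x \<in> S" "m2 x 0 \<noteq> 0"
    using initial_m2_pos infsum_0 by (metis (mono_tags, lifting) less_irrefl)
  have "0 < G x x * m2 x 0 * m2 x 0"
    using assms[OF x(1)] x(2) by (simp add: less_le)
  also have "\<dots> = (\<Sum>(x, y)\<in>{(x, x)}. G x y * m2 x 0 * m2 y 0)"
    by simp
  also have "\<dots> \<le> F 0"
    unfolding kernel_form_def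
    by (rule finite_sum_le_infsum[OF has_sum_imp_summable[OF kernel_bilinear_has_sum]])
       (use x m2_summable[OF zero_in_J] in \<open>auto simp: G_nonneg\<close>)
  finally show ?thesis
    using initial_m2_pos by (simp add: mean_fitness_eq)
qed

text \<open>If \<open>?u\<close> came before gelation, the linear upper bound for
  \<open>1 / M\<close> would be zero there, although \<open>M\<close> is still finite and
  positive.\<close>

lemma gel_time_upper:
  assumes "0 < mean_fitness 0"
  shows "gel_time S lam \<le> ereal (1 / (mean_fitness 0 * M 0))"
proof (rule ccontr)
  let ?u = "1 / (mean_fitness 0 * M 0)"
  assume "\<not> ?thesis"
  then have u: "?u \<in> J"
    using assms initial_m2_pos by (simp add: pregel_times_def)
  have "1 / M 0 - mean_fitness 0 * ?u = 0"
    using assms initial_m2_pos by simp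
  then show False
    using inverse_M_le[OF u] M_pos[OF u] by simp
qed

text \<open>An earlier gelation would leave \<open>1 / M\<close> bounded away from 0 up to that
  time, contradicting the blow-up of the second moment.\<close>

lemma gel_time_lower:
  assumes "0 < c" and fitness_le: "\<And>t. t \<in> J \<Longrightarrow> mean_fitness t \<le> c"
  shows "ereal (1 / (c * M 0)) \<le> gel_time S lam"
proof (rule ccontr)
  assume less: "\<not> ?thesis"
  have gel_pos: "0 < gel_time S lam"
    using solution by (simp add: coag_solution_def)
  obtain T where T: "gel_time S lam = ereal T" "0 < T" "T < 1 / (c * M 0)"
    using less gel_pos by (cases "gel_time S lam") auto
  \<comment> \<open>The value at \<open>T\<close> of the decreasing linear lower bound for
    \<open>1 / M\<close>; it is positive because \<open>T\<close> is too early.\<close>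
  define d where "d = 1 / M 0 - c * T"
  have "0 < d"
    using T \<open>0 < c\<close> initial_m2_pos by (simp add: d_def field_simps)
  have "(total_moment S lam 2 \<longlongrightarrow> \<infinity>) (at_left T)"
    using solution T(1) by (simp add: coag_solution_def)
  \<comment> \<open>The level \<open>1 / d\<close> is the bound that \<open>M\<close> cannot exceed
    before \<open>T\<close>, so crossing it gives the contradiction.\<close>
  then have "\<forall>\<^sub>F t in at_left T. ennreal (1 / d) < total_moment S lam 2 t"
    by (rule order_tendstoD) simp
  moreover have "\<forall>\<^sub>F t in at_left T. t \<in> {0<..<T}"
    using T(2) by (rule eventually_at_left_real)
  ultimately obtain t where t: "ennreal (1 / d) < total_moment S lam 2 t" "0 < t" "t < T"
    by (metis (mono_tags, lifting) eventually_conj eventually_happens greaterThanLessThan_iff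
        trivial_limit_at_left_real)
  then have tJ: "t \<in> J"
    by (simp add: pregel_times_def T(1))
  have "d \<le> 1 / M 0 - c * t"
    using t \<open>0 < c\<close> by (simp add: d_def)
  also have "\<dots> \<le> 1 / M t"
    by (rule inverse_M_ge[OF tJ fitness_le])
  finally have "M t \<le> 1 / d"
    using \<open>0 < d\<close> M_pos[OF tJ] by (simp add: field_simps)
  then show False
    using t(1) unfolding total_moment_eq(2)[OF tJ] by (meson ennreal_leI leD)
qed

end

theorem theorem3p8:
  fixes S :: "'s set"
    and G :: "'s \<Rightarrow> 's \<Rightarrow> real"
    and lam :: "real \<Rightarrow> nat \<Rightarrow> 's \<Rightarrow> real"
    and \<Phi> :: "'s \<Rightarrow> 'h :: {real_inner, complete_space}"
    and T1 :: real
  assumes "countable S"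
    and "\<And>x y. x \<in> S \<Longrightarrow> y \<in> S \<Longrightarrow> 0 < G x y"
    and "\<exists>C. \<forall>x\<in>S. \<forall>y\<in>S. G x y \<le> C"
    and "coag_solution S G lam"
    and "0 < T1" and "ereal T1 \<le> gel_time S lam"
    and "moment_control S G lam 1 T1"
    and "moment_control S G lam 2 T1"
    and "\<And>x y. x \<in> S \<Longrightarrow> y \<in> S \<Longrightarrow> G x y = inner (\<Phi> x) (\<Phi> y)"
  shows "inj_on (tau S lam) (pregel_times S lam)
    \<and> (\<forall>t\<in>pregel_times S lam. 0 < total_moment S lam 2 t \<and> total_moment S lam 2 t < \<infinity> \<longrightarrow>
         (\<forall>x\<in>S. ((\<lambda>u. prof_resc S lam u x) has_real_derivative
            prof_resc S lam (tau S lam t) x *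
              (kernel_app S G (prof_resc S lam (tau S lam t)) x
               - alpha_resc S G lam (tau S lam t)))
            (at (tau S lam t) within tau S lam ` pregel_times S lam)))
    \<and> mono_on (tau S lam ` pregel_times S lam) (alpha_resc S G lam)
    \<and> alpha_max S G < \<infinity>
    \<and> 1 / (alpha_max S G * ereal (enn2real (total_moment S lam 2 0))) \<le> gel_time S lam
    \<and> gel_time S lam \<le>
        (if alpha S G lam 0 = 0 then \<infinity>
         else 1 / ereal (alpha S G lam 0 * enn2real (total_moment S lam 2 0)))"
proof -
  obtain C0 where C0: "\<forall>x\<in>S. \<forall>y\<in>S. G x y \<le> C0"
    using assms(3) by blast
  \<comment> \<open>The maximum with 0 provides the nonnegative bound that the locale asks
    for.\<close>
  interpret coagulation S G "max 0 C0" lam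
  proof
    show "0 \<le> G x y" if "x \<in> S" "y \<in> S" for x y
      using assms(2)[OF that] by simp
    show "G x y \<le> max 0 C0" if "x \<in> S" "y \<in> S" for x y
      using C0 that by (simp add: le_max_iff_disj)
    show "G x y = G y x" if "x \<in> S" "y \<in> S" for x y
      using assms(9) that by (simp add: inner_commute)
  qed (use assms(4) in auto)
  have fitness_pos: "0 < mean_fitness 0"
    by (rule alpha_0_pos) (rule assms(2))
  \<comment> \<open>The supremum is real: it is finite from above, and the profile at time 0 bounds
    it from below.\<close>
  obtain c where c: "alpha_max S G = ereal c"
    using alpha_max_finite alpha_le_alpha_max[OF zero_in_J] by (cases "alpha_max S G") auto
  have fitness_le: "mean_fitness t \<le> c" if "t \<in> J" for t
    using alpha_le_alpha_max[OF that] c by simp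
  have "0 < c"
    using fitness_pos fitness_le[OF zero_in_J] by simp
  show ?thesis
  proof (intro conjI ballI impI)
    show "inj_on (tau S lam) J"
      using inj_on_rescaled_time tau_eq by (simp cong: inj_on_cong)
    show "alpha_max S G < \<infinity>"
      by (simp add: c)
    show "1 / (alpha_max S G * ereal (enn2real (total_moment S lam 2 0))) \<le> gel_time S lam"
      using gel_time_lower[OF \<open>0 < c\<close> fitness_le] \<open>0 < c\<close> initial_m2_pos
      by (simp add: c total_moment_eq(1)[OF zero_in_J] one_ereal_def)
    show "gel_time S lam \<le> (if alpha S G lam 0 = 0 then \<infinity>
         else 1 / ereal (alpha S G lam 0 * enn2real (total_moment S lam 2 0)))"
      using gel_time_upper[OF fitness_pos] fitness_pos initial_m2_pos
      by (simp add: alpha_eq[OF zero_in_J] total_moment_eq(1)[OF zero_in_J] one_ereal_def)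
  qed (auto intro: prof_resc_deriv alpha_resc_mono)
qed

end
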